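(* Let $\{\mathcal G,\Gamma_0,\Gamma_1\}$ be a quasi boundary triple for $T\subset A^*$ and assume that $A_1:=T\upharpoonright\ker\Gamma_1$ is self-adjoint in $\mathcal H$ and that $\mathscr G_0:=\operatorname{ran}(\Gamma_0\upharpoonright\ker\Gamma_1)$ is dense in $\mathcal G$. Then for any norm $\|\cdot\|_{\mathscr G_0}$ on $\mathscr G_0$ such that (i) $(\mathscr G_0,\|\cdot\|_{\mathscr G_0})$ is a reflexive Banach space continuously embedded in $\mathcal G$, and (ii) the operator $\Gamma_0(A_1-\bar\lambda)^{-1}:\mathcal H\to\mathscr G_0$ is continuous for some, and hence for all, $\lambda\in\rho(A_1)$, the boundary mapping $\Gamma_1$ admits a unique surjective, continuous extension $$\widetilde\Gamma_1:(\operatorname{dom}A^*,\|\cdot\|_{A^*})\to\mathscr G_0',$$ where $\mathscr G_0'$ is the anti-dual space of $\mathscr G_0$.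
   Context: Inner products are linear in the first and antilinear in the second argument. $\mathcal H$ is a separable Hilbert space, $A$ is a closed, densely defined, symmetric operator in $\mathcal H$ with adjoint $A^*$, and $\|\cdot\|_{A^*}$ is the graph norm of $A^*$. Quasi boundary triple: let $T\subset A^*$ be a linear operator in $\mathcal H$ with $\overline T=A^*$. A triple $\{\mathcal G,\Gamma_0,\Gamma_1\}$ is a quasi boundary triple for $T\subset A^*$ if $\mathcal G$ is a Hilbert space and $\Gamma_0,\Gamma_1:\operatorname{dom}T\to\mathcal G$ are linear maps such that (a) $(Tf,g)_{\mathcal H}-(f,Tg)_{\mathcal H}=(\Gamma_1f,\Gamma_0g)_{\mathcal G}-(\Gamma_0f,\Gamma_1g)_{\mathcal G}$ for all $f,g\in\operatorname{dom}T$; (b) $\Gamma=(\Gamma_0,\Gamma_1)^\top:\operatorname{dom}T\to\mathcal G\times\mathcal G$ has dense range; (c) $A_0:=T\upharpoonright\ker\Gamma_0$ is self-adjoint in $\mathcal H$. The anti-dual $\mathscr G_0'$ is the space of continuous antilinear functionals on $\mathscr G_0$; $\mathcal G$ is regarded as a subspace of $\mathscr G_0'$ via the inner product of $\mathcal G$. *)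

theory Defs
  imports "HOL-Analysis.Analysis" "HOL-Library.Function_Algebras"
begin

section \<open>Complex vector spaces and Hilbert spaces\<close>

class complex_vector = ab_group_add +
  fixes scaleC :: "complex \<Rightarrow> 'a \<Rightarrow> 'a"  (infixr \<open>*\<^sub>C\<close> 75)
  assumes scaleC_add_right: "a *\<^sub>C (x + y) = a *\<^sub>C x + a *\<^sub>C y"
    and scaleC_add_left: "(a + b) *\<^sub>C x = a *\<^sub>C x + b *\<^sub>C x"
    and scaleC_scaleC: "a *\<^sub>C b *\<^sub>C x = (a * b) *\<^sub>C x"
    and scaleC_one: "1 *\<^sub>C x = x"

interpretation complex_vector: vector_space "scaleC :: complex \<Rightarrow> 'a \<Rightarrow> 'a::complex_vector"
  by unfold_locales (rule scaleC_add_right scaleC_add_left scaleC_scaleC scaleC_one)+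

abbreviation csubspace :: "'a::complex_vector set \<Rightarrow> bool"
  where "csubspace \<equiv> module.subspace scaleC"

text \<open>
  The inner product is linear in the first and antilinear in the second argument. The last
  axiom carries both its positive definiteness and the fact that the norm is the induced one.
\<close>

class complex_inner = complex_vector + real_normed_vector +
  fixes cinner :: "'a \<Rightarrow> 'a \<Rightarrow> complex"
  assumes scaleR_scaleC: "r *\<^sub>R x = complex_of_real r *\<^sub>C x"
    and cinner_commute: "cinner x y = cnj (cinner y x)"
    and cinner_add_left: "cinner (x + y) z = cinner x z + cinner y z"
    and cinner_scaleC_left: "cinner (c *\<^sub>C x) y = c * cinner x y"
    and cinner_self: "cinner x x = complex_of_real ((norm x)\<^sup>2)"

class chilbert_space = complex_inner + complete_space

instantiation complex :: chilbert_space
begin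
definition scaleC_complex_def: "c *\<^sub>C (x::complex) = c * x"
definition cinner_complex_def: "cinner x (y::complex) = x * cnj y"
instance
proof
  fix a b c x y z :: complex and r :: real
  show "a *\<^sub>C (x + y) = a *\<^sub>C x + a *\<^sub>C y" "(a + b) *\<^sub>C x = a *\<^sub>C x + b *\<^sub>C x"
    by (simp_all add: scaleC_complex_def distrib_left distrib_right)
  show "a *\<^sub>C b *\<^sub>C x = (a * b) *\<^sub>C x" "1 *\<^sub>C x = x"
    by (simp_all add: scaleC_complex_def)
  show "r *\<^sub>R x = complex_of_real r *\<^sub>C x"
    by (simp add: scaleC_complex_def scaleR_conv_of_real)
  show "cinner x y = cnj (cinner y x)"
    by (simp add: cinner_complex_def)
  show "cinner (x + y) z = cinner x z + cinner y z" "cinner (c *\<^sub>C x) y = c * cinner x y"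
    by (simp_all add: cinner_complex_def scaleC_complex_def distrib_right)
  show "cinner x x = complex_of_real ((norm x)\<^sup>2)"
    unfolding cinner_complex_def by (rule complex_norm_square[symmetric])
qed
end

instantiation prod :: (complex_vector, complex_vector) complex_vector
begin
definition scaleC_prod_def: "c *\<^sub>C x = (c *\<^sub>C fst x, c *\<^sub>C snd x)"
instance
  by standard
    (simp_all add: scaleC_prod_def scaleC_add_right scaleC_add_left scaleC_scaleC scaleC_one)
end

instantiation "fun" :: (type, complex_vector) complex_vector
begin
definition scaleC_fun_def: "c *\<^sub>C f = (\<lambda>x. c *\<^sub>C f x)"
instance
  by standard
    (simp_all add: scaleC_fun_def fun_eq_iff scaleC_add_right scaleC_add_left scaleC_scaleC
      scaleC_one)
end

definition clinear_on :: "'a::complex_vector set \<Rightarrow> ('a \<Rightarrow> 'b::complex_vector) \<Rightarrow> bool" where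
  "clinear_on S f \<longleftrightarrow>
     (\<forall>x\<in>S. \<forall>y\<in>S. f (x + y) = f x + f y) \<and> (\<forall>c. \<forall>x\<in>S. f (c *\<^sub>C x) = c *\<^sub>C f x)"

definition antilinear_on :: "'a::complex_vector set \<Rightarrow> ('a \<Rightarrow> 'b::complex_vector) \<Rightarrow> bool" where
  "antilinear_on S f \<longleftrightarrow>
     (\<forall>x\<in>S. \<forall>y\<in>S. f (x + y) = f x + f y) \<and> (\<forall>c. \<forall>x\<in>S. f (c *\<^sub>C x) = cnj c *\<^sub>C f x)"


section \<open>Norms on subspaces, duals and reflexivity\<close>

text \<open>
  A normed space is a pair of a subspace \<open>S\<close> of some ambient complex vector space and a
  function \<open>N\<close>, whose values outside \<open>S\<close> are irrelevant.
\<close>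

definition norm_on :: "'a::complex_vector set \<Rightarrow> ('a \<Rightarrow> real) \<Rightarrow> bool" where
  "norm_on S N \<longleftrightarrow> csubspace S \<and>
     (\<forall>x\<in>S. 0 \<le> N x \<and> (N x = 0 \<longleftrightarrow> x = 0)) \<and>
     (\<forall>x\<in>S. \<forall>y\<in>S. N (x + y) \<le> N x + N y) \<and>
     (\<forall>c. \<forall>x\<in>S. N (c *\<^sub>C x) = cmod c * N x)"

text \<open>
  The value 0 off \<open>S\<close> is there because \<^locale>\<open>Metric_space\<close> asks for nonnegativity
  and symmetry on the whole type.
\<close>

definition norm_dist :: "'a::complex_vector set \<Rightarrow> ('a \<Rightarrow> real) \<Rightarrow> 'a \<Rightarrow> 'a \<Rightarrow> real" where
  "norm_dist S N x y = (if x \<in> S \<and> y \<in> S then N (x - y) else 0)"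

lemma Metric_space_norm_dist:
  assumes "norm_on S N"
  shows "Metric_space S (norm_dist S N)"
proof -
  have sub: "csubspace S" and pos: "\<And>x. x \<in> S \<Longrightarrow> 0 \<le> N x"
    and zero: "\<And>x. x \<in> S \<Longrightarrow> N x = 0 \<longleftrightarrow> x = 0"
    and tri: "\<And>x y. x \<in> S \<Longrightarrow> y \<in> S \<Longrightarrow> N (x + y) \<le> N x + N y"
    and hom: "\<And>c x. x \<in> S \<Longrightarrow> N (c *\<^sub>C x) = cmod c * N x"
    using assms unfolding norm_on_def by blast+
  have diff: "x - y \<in> S" if "x \<in> S" "y \<in> S" for x y
    using complex_vector.subspace_diff[OF sub that] .
  have comm: "N (x - y) = N (y - x)" if "x \<in> S" "y \<in> S" for x y
    using hom[OF diff[OF that], of "-1"] by simp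
  have tri': "N (x - z) \<le> N (x - y) + N (y - z)" if "x \<in> S" "y \<in> S" "z \<in> S" for x y z
    using tri[OF diff[OF that(1,2)] diff[OF that(2,3)]] by simp
  show ?thesis
  proof
    show "0 \<le> norm_dist S N x y" for x y
      using pos[OF diff] by (simp add: norm_dist_def)
    show "norm_dist S N x y = norm_dist S N y x" for x y
      by (simp add: norm_dist_def comm[of x y])
    show "norm_dist S N x y = 0 \<longleftrightarrow> x = y" if "x \<in> S" "y \<in> S" for x y
      using zero[OF diff[OF that]] that by (simp add: norm_dist_def)
    show "norm_dist S N x z \<le> norm_dist S N x y + norm_dist S N y z"
      if "x \<in> S" "y \<in> S" "z \<in> S" for x y z
      using tri'[OF that] that by (simp add: norm_dist_def)
  qed
qed

definition norm_topology :: "'a::complex_vector set \<Rightarrow> ('a \<Rightarrow> real) \<Rightarrow> 'a topology" where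
  "norm_topology S N = Metric_space.mtopology S (norm_dist S N)"

definition banach_on :: "'a::complex_vector set \<Rightarrow> ('a \<Rightarrow> real) \<Rightarrow> bool" where
  "banach_on S N \<longleftrightarrow> norm_on S N \<and> Metric_space.mcomplete S (norm_dist S N)"

text \<open>
  Functionals on \<open>S\<close> are represented by functions on the ambient type that vanish off \<open>S\<close>,
  so that distinct functions in the dual or anti-dual are distinct functionals.
\<close>

definition dual_space :: "'a::complex_vector set \<Rightarrow> ('a \<Rightarrow> real) \<Rightarrow> ('a \<Rightarrow> complex) set" where
  "dual_space S N =
     {\<phi>. clinear_on S \<phi> \<and> continuous_map (norm_topology S N) euclidean \<phi> \<and> (\<forall>x. x \<notin> S \<longrightarrow> \<phi> x = 0)}"

definition antidual_space :: "'a::complex_vector set \<Rightarrow> ('a \<Rightarrow> real) \<Rightarrow> ('a \<Rightarrow> complex) set" where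
  "antidual_space S N =
     {\<phi>. antilinear_on S \<phi> \<and> continuous_map (norm_topology S N) euclidean \<phi> \<and> (\<forall>x. x \<notin> S \<longrightarrow> \<phi> x = 0)}"

definition dual_norm :: "'a::complex_vector set \<Rightarrow> ('a \<Rightarrow> real) \<Rightarrow> ('a \<Rightarrow> complex) \<Rightarrow> real" where
  "dual_norm S N \<phi> = (SUP x\<in>{x\<in>S. N x \<le> 1}. cmod (\<phi> x))"

text \<open>The canonical map of \<open>S\<close> into its bidual is onto.\<close>

definition reflexive_on :: "'a::complex_vector set \<Rightarrow> ('a \<Rightarrow> real) \<Rightarrow> bool" where
  "reflexive_on S N \<longleftrightarrow>
     (\<forall>\<Psi> \<in> dual_space (dual_space S N) (dual_norm S N).
        \<exists>x\<in>S. \<forall>\<phi>\<in>dual_space S N. \<Psi> \<phi> = \<phi> x)"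

definition to_antidual :: "'a::complex_inner set \<Rightarrow> 'a \<Rightarrow> 'a \<Rightarrow> complex" where
  "to_antidual S g = (\<lambda>x. if x \<in> S then cinner g x else 0)"


section \<open>Unbounded operators\<close>

text \<open>
  An operator is identified with its graph, so that inclusion, closure and closedness of
  operators are those of the graphs and \<^const>\<open>Domain\<close> is the operator domain.
\<close>

type_synonym 'h operator = "('h \<times> 'h) set"

definition linear_operator :: "'h::complex_vector operator \<Rightarrow> bool" where
  "linear_operator B \<longleftrightarrow> csubspace B \<and> single_valued B"

definition op_app :: "'h operator \<Rightarrow> 'h \<Rightarrow> 'h" where
  "op_app B f = (THE g. (f, g) \<in> B)"

definition op_restrict :: "'h operator \<Rightarrow> 'h set \<Rightarrow> 'h operator" where
  "op_restrict B S = {(f, g) \<in> B. f \<in> S}"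

definition densely_defined :: "'h::topological_space operator \<Rightarrow> bool" where
  "densely_defined B \<longleftrightarrow> closure (Domain B) = UNIV"

definition symmetric_operator :: "'h::complex_inner operator \<Rightarrow> bool" where
  "symmetric_operator B \<longleftrightarrow> (\<forall>(f, f')\<in>B. \<forall>(g, g')\<in>B. cinner f' g = cinner f g')"

definition adjoint_op :: "'h::complex_inner operator \<Rightarrow> 'h operator" where
  "adjoint_op B = {(g, g'). \<forall>(f, f')\<in>B. cinner f' g = cinner f g'}"

definition self_adjoint :: "'h::complex_inner operator \<Rightarrow> bool" where
  "self_adjoint B \<longleftrightarrow> linear_operator B \<and> densely_defined B \<and> adjoint_op B = B"

definition op_minus_scalar :: "'h::complex_vector operator \<Rightarrow> complex \<Rightarrow> 'h operator" where
  "op_minus_scalar B z = {(f, g - z *\<^sub>C f) | f g. (f, g) \<in> B}"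

definition resolvent :: "'h::complex_vector operator \<Rightarrow> complex \<Rightarrow> 'h \<Rightarrow> 'h" where
  "resolvent B z = op_app ((op_minus_scalar B z)\<inverse>)"

definition resolvent_set :: "'h::complex_inner operator \<Rightarrow> complex set" where
  "resolvent_set B =
     {z. single_valued ((op_minus_scalar B z)\<inverse>) \<and> Range (op_minus_scalar B z) = UNIV \<and>
         continuous_on UNIV (resolvent B z)}"

definition graph_norm :: "'h::real_normed_vector operator \<Rightarrow> 'h \<Rightarrow> real" where
  "graph_norm B f = sqrt ((norm f)\<^sup>2 + (norm (op_app B f))\<^sup>2)"


section \<open>Quasi boundary triples\<close>

text \<open>
  The boundary maps are total functions of which only the values on \<open>Domain T\<close> matter; the
  boundary space is the type \<open>'g\<close>.
\<close>

definition ker_on :: "'a set \<Rightarrow> ('a \<Rightarrow> 'b::zero) \<Rightarrow> 'a set" where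
  "ker_on S f = {x\<in>S. f x = 0}"

definition quasi_boundary_triple ::
  "'h::complex_inner operator \<Rightarrow> 'h operator \<Rightarrow>
     ('h \<Rightarrow> 'g::chilbert_space) \<Rightarrow> ('h \<Rightarrow> 'g) \<Rightarrow> bool" where
  "quasi_boundary_triple A T \<Gamma>0 \<Gamma>1 \<longleftrightarrow>
     linear_operator T \<and> T \<subseteq> adjoint_op A \<and> closure T = adjoint_op A \<and>
     clinear_on (Domain T) \<Gamma>0 \<and> clinear_on (Domain T) \<Gamma>1 \<and>
     (\<forall>f\<in>Domain T. \<forall>g\<in>Domain T.
        cinner (op_app T f) g - cinner f (op_app T g)
          = cinner (\<Gamma>1 f) (\<Gamma>0 g) - cinner (\<Gamma>0 f) (\<Gamma>1 g)) \<and>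
     closure ((\<lambda>f. (\<Gamma>0 f, \<Gamma>1 f)) ` Domain T) = UNIV \<and>
     self_adjoint (op_restrict T (ker_on (Domain T) \<Gamma>0))"

end

theory Submission
  imports Defs
begin

text \<open>
  Write \<open>(\<cdot>,\<cdot>)\<close> for inner products. For \<open>f \<in> dom T\<close> and \<open>u \<in> ker \<Gamma>1 = dom A1\<close>, Green's identity reads
  \<open>(\<Gamma>1 f, \<Gamma>0 u) = (T f, u) - (f, A1 u)\<close>, and \<open>\<Gamma>0 u\<close> runs through all of \<open>G0\<close>. The right-hand side
  makes sense for every \<open>f \<in> dom A\<^sup>*\<close> once \<open>T f\<close> is replaced by \<open>A\<^sup>* f\<close>, and this is the extension.

  It depends on \<open>\<Gamma>0 u\<close> alone (\<open>Green_vanishes\<close>) because \<open>T\<close> is dense in the graph of \<open>A\<^sup>*\<close>. It is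
  bounded (\<open>\<Gamma>1_ext_bounded\<close>) by the uniform boundedness principle on the Banach space \<open>G0\<close>: for
  \<open>f\<close> in the unit ball of \<open>dom T\<close>, the functionals \<open>(\<Gamma>1 f, \<cdot>)\<close> are continuous on \<open>G0\<close>, and at
  \<open>\<Gamma>0 u\<close> they are bounded by the right-hand side of Green's identity. Uniqueness is density of
  \<open>dom T\<close> in \<open>dom A\<^sup>*\<close> for the graph norm.

  For surjectivity (\<open>\<Gamma>1_ext_surjective\<close>), a functional \<open>\<phi>\<close> in the anti-dual is composed with the
  continuous map \<open>\<Gamma>0 (A1 - w)\<inverse>\<close> from the Hilbert space to \<open>G0\<close> and represented by a vector \<open>k\<close>.
  Both boundary maps vanish on \<open>dom A\<close>, so \<open>k\<close> is orthogonal to \<open>ran (A - w)\<close>, that is,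
  \<open>k \<in> ker (A\<^sup>* - cnj w)\<close>; and \<open>-k\<close> is mapped to \<open>\<phi>\<close>.

  That continuity of \<open>\<Gamma>0 (A1 - w)\<inverse>\<close> passes from one \<open>w\<close> in the resolvent set to all others is the
  resolvent identity. The resolvent set of a self-adjoint operator is invariant under conjugation
  (\<open>resolvent_set_cnj\<close>), so it is immaterial whether \<open>w\<close> or \<open>cnj w\<close> is used.
\<close>

section \<open>Complex inner product spaces\<close>

lemma cinner_add_right: "cinner x (y + z) = cinner x y + cinner x z"
  by (metis cinner_add_left cinner_commute complex_cnj_add)

lemma cinner_scaleC_right: "cinner x (c *\<^sub>C y) = cnj c * cinner x y"
  by (metis cinner_commute cinner_scaleC_left complex_cnj_mult)

lemma norm_scaleC: "norm (c *\<^sub>C x) = cmod c * norm (x :: 'a::complex_inner)"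
proof -
  have "complex_of_real ((norm (c *\<^sub>C x))\<^sup>2) = c * cnj c * complex_of_real ((norm x)\<^sup>2)"
    by (metis cinner_self cinner_scaleC_left cinner_scaleC_right mult.assoc)
  also have "\<dots> = complex_of_real ((cmod c * norm x)\<^sup>2)"
    by (simp add: complex_norm_square[symmetric] power_mult_distrib)
  finally have "(norm (c *\<^sub>C x))\<^sup>2 = (cmod c * norm x)\<^sup>2"
    using of_real_eq_iff by blast
  then show ?thesis by (simp add: power2_eq_iff_nonneg)
qed

lemma norm_add_square:
  "(norm (x + y))\<^sup>2 = (norm x)\<^sup>2 + (norm y)\<^sup>2 + 2 * Re (cinner x (y :: 'a::complex_inner))"
proof -
  have "complex_of_real ((norm (x + y))\<^sup>2) =
      complex_of_real ((norm x)\<^sup>2) + complex_of_real ((norm y)\<^sup>2) + (cinner x y + cnj (cinner x y))"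
    by (simp only: cinner_self[symmetric] cinner_add_left cinner_add_right
        cinner_commute[of y x] ac_simps)
  then show ?thesis
    by (auto simp: complex_eq_iff)
qed

lemma Cauchy_Schwarz: "cmod (cinner x y) \<le> norm x * norm (y :: 'a::complex_inner)"
proof (cases "y = 0")
  case True
  then show ?thesis
    using cinner_scaleC_right[of x 0 y] by simp
next
  case False
  define n where "n = (norm y)\<^sup>2"
  have n: "n > 0" using False by (simp add: n_def)
  \<comment> \<open>\<open>c *\<^sub>C y\<close> is minus the projection of \<open>x\<close> to the line through \<open>y\<close>.\<close>
  define c where "c = - (cinner x y / complex_of_real n)"
  have "0 \<le> (norm (x + c *\<^sub>C y))\<^sup>2" by simp
  also have "\<dots> = (norm x)\<^sup>2 + (cmod c)\<^sup>2 * n + 2 * Re (cnj c * cinner x y)"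
    by (simp add: norm_add_square norm_scaleC cinner_scaleC_right power_mult_distrib n_def)
  also have "cnj c * cinner x y = - complex_of_real ((cmod (cinner x y))\<^sup>2 / n)"
    using complex_norm_square[of "cinner x y"] by (simp add: c_def mult.commute)
  also have "(cmod c)\<^sup>2 * n = (cmod (cinner x y))\<^sup>2 / n"
    using n by (simp add: c_def norm_divide power_divide power2_eq_square)
  finally have "(cmod (cinner x y))\<^sup>2 / n \<le> (norm x)\<^sup>2" by simp
  then have "(cmod (cinner x y))\<^sup>2 \<le> (norm x * norm y)\<^sup>2"
    using n by (simp add: field_simps n_def)
  then show ?thesis by (simp add: power2_le_iff_abs_le)
qed

lemma bounded_bilinear_cinner:
  "bounded_bilinear (cinner :: 'a::complex_inner \<Rightarrow> 'a \<Rightarrow> complex)"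
proof
  show "\<exists>K. \<forall>a b::'a. norm (cinner a b) \<le> norm a * norm b * K"
    using Cauchy_Schwarz by (metis mult.right_neutral)
qed (simp_all add: cinner_add_left cinner_add_right scaleR_scaleC cinner_scaleC_left
      cinner_scaleC_right scaleC_complex_def)

interpretation cinner: bounded_bilinear "cinner :: 'a::complex_inner \<Rightarrow> 'a \<Rightarrow> complex"
  by (rule bounded_bilinear_cinner)

lemma cinner_left_cancel:
  assumes "\<And>x. cinner x y = cinner x (z :: 'a::complex_inner)"
  shows "y = z"
proof -
  have "complex_of_real ((norm (y - z))\<^sup>2) = 0"
    unfolding cinner_self[symmetric] using assms[of "y - z"] by (simp add: cinner.diff_right)
  then show ?thesis by simp
qed

text \<open>
  The representing vector minimises \<open>\<parallel>x\<parallel>\<^sup>2 - 2 Re f(x)\<close>: the parallelogram law makes every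
  minimising sequence Cauchy, and the vanishing of the first variation at the minimum is the
  representation.
\<close>

theorem Riesz_representation:
  fixes f :: "'a::chilbert_space \<Rightarrow> complex"
  assumes lin: "clinear_on UNIV f" and bdd: "\<And>x. cmod (f x) \<le> C * norm x"
  obtains a where "\<And>x. f x = cinner x a"
proof -
  have add: "f (x + y) = f x + f y" and scale: "f (c *\<^sub>C x) = c * f x" for x y c
    using lin by (auto simp: clinear_on_def scaleC_complex_def)
  have blin: "bounded_linear f"
    by (rule bounded_linear_intro[where K = C])
      (use add scale bdd in \<open>auto simp: scaleR_scaleC scaleC_complex_def mult.commute\<close>)
  define Q where "Q x = (norm x)\<^sup>2 - 2 * Re (f x)" for x
  have Q_add: "Q (x + y) = Q x + Q y + 2 * Re (cinner x y)" for x y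
    by (simp add: Q_def norm_add_square add)
  have Q_scaleR: "Q (r *\<^sub>R x) = r\<^sup>2 * (norm x)\<^sup>2 - 2 * r * Re (f x)" for r x
    by (simp add: Q_def power_mult_distrib scaleR_scaleC scale norm_scaleC)
  have parallelogram: "(norm (x - y))\<^sup>2 = 2 * Q x + 2 * Q y - 4 * Q ((1/2) *\<^sub>R (x + y))" for x y
  proof -
    have "4 * Q ((1/2) *\<^sub>R (x + y)) = (norm (x + y))\<^sup>2 - 4 * Re (f x) - 4 * Re (f y)"
      unfolding Q_scaleR by (simp add: add power_divide)
    then show ?thesis
      using norm_add_square[of x y] norm_add_square[of x "-y"]
      by (simp add: Q_def cinner.minus_right)
  qed
  have Q_lower: "- C\<^sup>2 \<le> Q x" for x
  proof -
    have "Re (f x) \<le> C * norm x" using bdd[of x] complex_Re_le_cmod[of "f x"] by linarith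
    moreover have "2 * (C * norm x) \<le> (norm x)\<^sup>2 + C\<^sup>2"
      using zero_le_power2[of "norm x - C"] by (simp add: power2_diff algebra_simps)
    ultimately show ?thesis unfolding Q_def by linarith
  qed
  then have bdd_Q: "bdd_below (range Q)" by (auto intro!: bdd_belowI)
  define d where "d = (INF x. Q x)"
  have d: "d \<le> Q x" for x unfolding d_def by (rule cINF_lower[OF bdd_Q]) simp
  have "\<exists>x. Q x < d + 1 / real (Suc n)" for n
    using cINF_less_iff[OF _ bdd_Q, of "d + 1 / real (Suc n)"] by (simp add: d_def)
  then obtain s where s: "\<And>n. Q (s n) < d + 1 / real (Suc n)" by metis
  have "Cauchy s"
  proof (rule metric_CauchyI)
    fix e :: real assume e: "e > 0"
    then obtain M where M: "inverse (real (Suc M)) < e\<^sup>2 / 4"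
      using reals_Archimedean[of "e\<^sup>2 / 4"] by auto
    have "dist (s m) (s n) < e" if "m \<ge> M" "n \<ge> M" for m n
    proof -
      have small: "1 / real (Suc k) \<le> inverse (real (Suc M))" if "k \<ge> M" for k
        using that by (simp add: field_simps)
      have "(norm (s m - s n))\<^sup>2 < e\<^sup>2"
        using parallelogram[of "s m" "s n"] s[of m] s[of n] small[OF that(1)] small[OF that(2)] M
          d[of "(1/2) *\<^sub>R (s m + s n)"] by linarith
      then show ?thesis using e by (simp add: dist_norm power_less_imp_less_base)
    qed
    then show "\<exists>M. \<forall>m\<ge>M. \<forall>n\<ge>M. dist (s m) (s n) < e" by blast
  qed
  then obtain a where a: "s \<longlonglongrightarrow> a" using Cauchy_convergent convergent_def by blast
  have "(\<lambda>n. Q (s n)) \<longlonglongrightarrow> Q a"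
    unfolding Q_def by (intro tendsto_intros bounded_linear.tendsto[OF blin] a)
  moreover have "(\<lambda>n. d + 1 / real (Suc n)) \<longlonglongrightarrow> d"
    using tendsto_add[OF tendsto_const LIMSEQ_inverse_real_of_nat, of d]
    by (simp add: inverse_eq_divide)
  ultimately have "Q a \<le> d"
    using s by (meson LIMSEQ_le less_imp_le)
  then have min: "Q a \<le> Q x" for x using d[of x] by linarith
  have Re: "Re (f y) = Re (cinner y a)" for y
  proof -
    define p where "p = Re (cinner y a) - Re (f y)"
    have ineq: "0 \<le> r\<^sup>2 * (norm y)\<^sup>2 + 2 * r * p" for r
    proof -
      have "Re (cinner a y) = Re (cinner y a)" by (metis cinner_commute cnj.sel(1))
      then show ?thesis
        using min[of "a + r *\<^sub>R y"]
        by (simp add: Q_add Q_scaleR cinner.scaleR_right p_def algebra_simps)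
    qed
    define q where "q = (norm y)\<^sup>2 + 1"
    have q: "q > 0" using zero_le_power2[of "norm y"] unfolding q_def by linarith
    \<comment> \<open>This \<open>r\<close> makes the linear term win over the quadratic one unless \<open>p = 0\<close>.\<close>
    define r where "r = - p / q"
    have "r\<^sup>2 * (norm y)\<^sup>2 + 2 * r * p \<le> r\<^sup>2 * q + 2 * r * p"
      by (simp add: q_def distrib_left)
    also have "\<dots> = - (p\<^sup>2 / q)"
      using q by (simp add: r_def field_simps power2_eq_square)
    finally have "p\<^sup>2 / q \<le> 0" using ineq[of r] by linarith
    then have "p\<^sup>2 \<le> 0" using q by (simp add: divide_le_0_iff)
    then show ?thesis by (simp add: p_def)
  qed
  have "f x = cinner x a" for x
    using Re[of x] Re[of "\<i> *\<^sub>C x"] by (simp add: complex_eq_iff scale cinner_scaleC_left)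
  then show ?thesis by (rule that)
qed

section \<open>Bounded maps between normed subspaces\<close>

lemma norm_onD:
  assumes "norm_on S N"
  shows "csubspace S" and "x \<in> S \<Longrightarrow> 0 \<le> N x" and "x \<in> S \<Longrightarrow> N x = 0 \<longleftrightarrow> x = 0"
    and "x \<in> S \<Longrightarrow> y \<in> S \<Longrightarrow> N (x + y) \<le> N x + N y"
    and "x \<in> S \<Longrightarrow> N (c *\<^sub>C x) = cmod c * N x"
  using assms unfolding norm_on_def by blast+

lemma norm_on_UNIV: "norm_on UNIV (norm :: 'a::complex_inner \<Rightarrow> real)"
  by (auto simp: norm_on_def norm_scaleC norm_triangle_ineq complex_vector.subspace_UNIV)

lemma norm_topology_UNIV: "norm_topology UNIV norm = (euclidean :: 'a::complex_inner topology)"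
proof -
  have "norm_dist UNIV norm = (dist :: 'a \<Rightarrow> 'a \<Rightarrow> real)"
    by (simp add: fun_eq_iff norm_dist_def dist_norm)
  then show ?thesis by (simp add: norm_topology_def)
qed

text \<open>Linear and antilinear maps are treated together as maps that are linear over the reals.\<close>

definition rlinear_on :: "'a::complex_vector set \<Rightarrow> ('a \<Rightarrow> 'b::complex_vector) \<Rightarrow> bool" where
  "rlinear_on S f \<longleftrightarrow> (\<forall>x\<in>S. \<forall>y\<in>S. f (x + y) = f x + f y) \<and>
     (\<forall>r. \<forall>x\<in>S. f (complex_of_real r *\<^sub>C x) = complex_of_real r *\<^sub>C f x)"

lemma clinear_on_imp_rlinear_on: "clinear_on S f \<Longrightarrow> rlinear_on S f"
  by (simp add: clinear_on_def rlinear_on_def)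

lemma antilinear_on_imp_rlinear_on: "antilinear_on S f \<Longrightarrow> rlinear_on S f"
  by (simp add: antilinear_on_def rlinear_on_def)

lemma rlinear_on_0:
  assumes "rlinear_on S f" "csubspace S"
  shows "f 0 = 0"
proof -
  have "f (complex_of_real 0 *\<^sub>C 0) = complex_of_real 0 *\<^sub>C f 0"
    using assms complex_vector.subspace_0 unfolding rlinear_on_def by blast
  then show ?thesis by simp
qed

lemma rlinear_on_diff:
  assumes "rlinear_on S f" "csubspace S" "x \<in> S" "y \<in> S"
  shows "f (x - y) = f x - f y"
proof -
  have "f (complex_of_real (-1) *\<^sub>C y) = complex_of_real (-1) *\<^sub>C f y"
    using assms unfolding rlinear_on_def by blast
  moreover have "f (x + - y) = f x + f (- y)"
    using assms complex_vector.subspace_neg unfolding rlinear_on_def by blast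
  ultimately show ?thesis by simp
qed

text \<open>
  Scale \<open>x\<close> to norm \<open>r / 2\<close>, which is inside the open ball of radius \<open>r\<close>. The assumption on
  \<open>M\<close> covers norms that are given on a subspace containing the range of \<open>f\<close>.
\<close>

lemma bounded_by_scaling:
  assumes S: "norm_on S N" and f: "rlinear_on S f" and r: "r > 0"
    and M: "\<And>t x. x \<in> S \<Longrightarrow> M (complex_of_real t *\<^sub>C f x) = \<bar>t\<bar> * M (f x)"
    and ball: "\<And>x. x \<in> S \<Longrightarrow> N x < r \<Longrightarrow> M (f x) \<le> c"
    and x: "x \<in> S"
  shows "M (f x) \<le> 2 * c / r * N x"
proof (cases "x = 0")
  case True
  have "f 0 = 0" using f norm_onD(1)[OF S] by (rule rlinear_on_0)
  then show ?thesis
    using M[of 0 0] norm_onD(3)[OF S x] True x by simp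
next
  case False
  have pos: "N x > 0" using norm_onD(2,3)[OF S x] False by linarith
  define t where "t = r / (2 * N x)"
  have t: "t > 0" using pos r by (simp add: t_def)
  have tx: "complex_of_real t *\<^sub>C x \<in> S"
    using norm_onD(1)[OF S] x by (rule complex_vector.subspace_scale)
  have "N (complex_of_real t *\<^sub>C x) = t * N x"
    using norm_onD(5)[OF S x, of "complex_of_real t"] t by simp
  also have "\<dots> = r / 2" using pos by (simp add: t_def)
  finally have "M (f (complex_of_real t *\<^sub>C x)) \<le> c" using ball[OF tx] r by simp
  moreover have "f (complex_of_real t *\<^sub>C x) = complex_of_real t *\<^sub>C f x"
    using f x unfolding rlinear_on_def by blast
  ultimately have "t * M (f x) \<le> c" using M[OF x, of t] t by simp
  then show ?thesis using pos r by (simp add: t_def field_simps)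
qed

theorem continuous_iff_bounded:
  assumes S: "norm_on S N" and T: "norm_on T M" and f: "rlinear_on S f" and im: "f ` S \<subseteq> T"
  shows "continuous_map (norm_topology S N) (norm_topology T M) f \<longleftrightarrow>
    (\<exists>C\<ge>0. \<forall>x\<in>S. M (f x) \<le> C * N x)"
proof -
  have cont: "continuous_map (norm_topology S N) (norm_topology T M) f \<longleftrightarrow>
      (\<forall>a\<in>S. \<forall>\<epsilon>>0. \<exists>\<delta>>0. \<forall>x. x \<in> S \<and> norm_dist S N a x < \<delta> \<longrightarrow> norm_dist T M (f a) (f x) < \<epsilon>)"
    unfolding norm_topology_def
    using Metric_space.metric_continuous_map[OF Metric_space_norm_dist[OF S]
        Metric_space_norm_dist[OF T]] im by blast
  have dist: "norm_dist T M (f a) (f x) = M (f (a - x))" "norm_dist S N a x = N (a - x)"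
    if "a \<in> S" "x \<in> S" for a x
    using that im rlinear_on_diff[OF f norm_onD(1)[OF S] that] by (auto simp: norm_dist_def)
  show ?thesis
  proof
    assume "continuous_map (norm_topology S N) (norm_topology T M) f"
    moreover have S0: "0 \<in> S" using norm_onD(1)[OF S] complex_vector.subspace_0 by blast
    ultimately obtain \<delta> where \<delta>: "\<delta> > 0"
      "\<And>x. x \<in> S \<Longrightarrow> norm_dist S N 0 x < \<delta> \<Longrightarrow> norm_dist T M (f 0) (f x) < 1"
      unfolding cont by (meson zero_less_one)
    have "M (f x) \<le> 1" if "x \<in> S" "N x < \<delta>" for x
    proof -
      have "- x \<in> S" using norm_onD(1)[OF S] that(1) by (rule complex_vector.subspace_neg)
      moreover have "N (- x) = N x" using norm_onD(5)[OF S that(1), of "-1"] by simp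
      ultimately show ?thesis using \<delta>(2)[of "- x"] dist[OF S0, of "- x"] that by simp
    qed
    moreover have "M (complex_of_real t *\<^sub>C f x) = \<bar>t\<bar> * M (f x)" if "x \<in> S" for t x
      using norm_onD(5)[OF T, of "f x" "complex_of_real t"] im that by auto
    ultimately have "\<forall>x\<in>S. M (f x) \<le> 2 * 1 / \<delta> * N x"
      using bounded_by_scaling[OF S f \<delta>(1), of M 1] by blast
    then show "\<exists>C\<ge>0. \<forall>x\<in>S. M (f x) \<le> C * N x"
      using \<delta>(1) by (intro exI[of _ "2 * 1 / \<delta>"]) simp
  next
    assume "\<exists>C\<ge>0. \<forall>x\<in>S. M (f x) \<le> C * N x"
    then obtain C where C: "C \<ge> 0" "\<And>x. x \<in> S \<Longrightarrow> M (f x) \<le> C * N x" by blast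
    show "continuous_map (norm_topology S N) (norm_topology T M) f"
      unfolding cont
    proof (intro ballI allI impI)
      fix a and \<epsilon> :: real assume a: "a \<in> S" and \<epsilon>: "\<epsilon> > 0"
      have "norm_dist T M (f a) (f x) < \<epsilon>" if x: "x \<in> S" "norm_dist S N a x < \<epsilon> / (C + 1)" for x
      proof -
        have ax: "a - x \<in> S" using norm_onD(1)[OF S] a x(1) by (rule complex_vector.subspace_diff)
        have "M (f (a - x)) \<le> (C + 1) * N (a - x)"
          using C(2)[OF ax] norm_onD(2)[OF S ax] by (simp add: distrib_right)
        also have "\<dots> < \<epsilon>" using x(2) dist(2)[OF a x(1)] C(1) by (simp add: field_simps)
        finally show ?thesis using dist(1)[OF a x(1)] by simp
      qed
      moreover have "\<epsilon> / (C + 1) > 0" using \<epsilon> C(1) by simp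
      ultimately show "\<exists>\<delta>>0. \<forall>x. x \<in> S \<and> norm_dist S N a x < \<delta> \<longrightarrow> norm_dist T M (f a) (f x) < \<epsilon>"
        by blast
    qed
  qed
qed

corollary continuous_functional_iff_bounded:
  fixes f :: "'a::complex_vector \<Rightarrow> 'b::complex_inner"
  assumes "norm_on S N" "rlinear_on S f"
  shows "continuous_map (norm_topology S N) euclidean f \<longleftrightarrow> (\<exists>C\<ge>0. \<forall>x\<in>S. norm (f x) \<le> C * N x)"
  using continuous_iff_bounded[OF assms(1) norm_on_UNIV assms(2)] by (simp add: norm_topology_UNIV)

text \<open>
  By the Baire category theorem, one of the closed sets on which the family is bounded by a fixed
  \<open>n\<close> contains a ball; the differences of its points from the centre fill a ball around \<open>0\<close>.
\<close>

theorem Banach_Steinhaus: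
  fixes \<Phi> :: "('a::complex_vector \<Rightarrow> 'b::complex_inner) set"
  assumes S: "banach_on S N" and lin: "\<And>\<phi>. \<phi> \<in> \<Phi> \<Longrightarrow> rlinear_on S \<phi>"
    and cont: "\<And>\<phi>. \<phi> \<in> \<Phi> \<Longrightarrow> continuous_map (norm_topology S N) euclidean \<phi>"
    and pointwise: "\<And>x. x \<in> S \<Longrightarrow> \<exists>C. \<forall>\<phi>\<in>\<Phi>. norm (\<phi> x) \<le> C"
  shows "\<exists>C\<ge>0. \<forall>\<phi>\<in>\<Phi>. \<forall>x\<in>S. norm (\<phi> x) \<le> C * N x"
proof -
  have N: "norm_on S N" and complete: "Metric_space.mcomplete S (norm_dist S N)"
    using S by (auto simp: banach_on_def)
  interpret Metric_space S "norm_dist S N" by (rule Metric_space_norm_dist[OF N])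
  have top: "norm_topology S N = mtopology" by (simp add: norm_topology_def)
  define E where "E n = {x\<in>S. \<forall>\<phi>\<in>\<Phi>. norm (\<phi> x) \<le> real n}" for n
  have closed: "closedin mtopology (E n)" for n
  proof -
    have "closedin mtopology {x \<in> topspace mtopology. \<phi> x \<in> cball 0 (real n)}" if "\<phi> \<in> \<Phi>" for \<phi>
      by (rule closedin_continuous_map_preimage[OF cont[OF that, unfolded top]]) simp
    then have "closedin mtopology {x\<in>S. norm (\<phi> x) \<le> real n}" if "\<phi> \<in> \<Phi>" for \<phi>
      using that by simp
    then have "closedin mtopology (\<Inter>\<phi>\<in>\<Phi>. {x\<in>S. norm (\<phi> x) \<le> real n})" if "\<Phi> \<noteq> {}"
      using that by (intro closedin_INT) auto
    moreover have "E n = S" if "\<Phi> = {}" using that by (auto simp: E_def)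
    moreover have "E n = (\<Inter>\<phi>\<in>\<Phi>. {x\<in>S. norm (\<phi> x) \<le> real n})" if "\<Phi> \<noteq> {}"
      using that by (auto simp: E_def)
    ultimately show ?thesis
      using closedin_topspace[of mtopology] by (cases "\<Phi> = {}") simp_all
  qed
  have cover: "\<Union>(range E) = S"
  proof
    show "S \<subseteq> \<Union>(range E)"
    proof
      fix x assume x: "x \<in> S"
      then obtain C where C: "\<forall>\<phi>\<in>\<Phi>. norm (\<phi> x) \<le> C" using pointwise by blast
      obtain n where "C \<le> real n" using real_arch_simple by blast
      then have "x \<in> E n" using C x by (force simp: E_def)
      then show "x \<in> \<Union>(range E)" by blast
    qed
  qed (auto simp: E_def)
  have "mtopology interior_of \<Union>(range E) \<noteq> {}"
    using complex_vector.subspace_0[OF norm_onD(1)[OF N]] interior_of_topspace[of mtopology]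
    by (auto simp: cover)
  then obtain n where "mtopology interior_of (E n) \<noteq> {}"
    using metric_Baire_category_alt[OF complete, of "range E"] closed by auto
  then obtain a r where a: "a \<in> S" and r: "r > 0" and ball: "mball a r \<subseteq> E n"
    using in_interior_of_mball by blast
  have small: "norm (\<phi> x) \<le> 2 * real n" if \<phi>: "\<phi> \<in> \<Phi>" and x: "x \<in> S" "N x < r" for \<phi> x
  proof -
    have ax: "a + x \<in> S" using norm_onD(1)[OF N] a x(1) by (rule complex_vector.subspace_add)
    have "N (- x) = N x" using norm_onD(5)[OF N x(1), of "-1"] by simp
    then have "a + x \<in> E n" "a \<in> E n"
      using ball a ax r x norm_onD(3)[OF N, of 0]
      by (auto simp: norm_dist_def subset_iff complex_vector.subspace_0[OF norm_onD(1)[OF N]])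
    then have "norm (\<phi> (a + x)) \<le> real n" "norm (\<phi> a) \<le> real n" using \<phi> by (auto simp: E_def)
    moreover have "\<phi> (a + x) = \<phi> a + \<phi> x" using lin[OF \<phi>] a x(1) by (simp add: rlinear_on_def)
    ultimately show ?thesis
      using norm_triangle_ineq4[of "\<phi> (a + x)" "\<phi> a"] by simp
  qed
  have "norm (\<phi> x) \<le> 2 * (2 * real n) / r * N x" if "\<phi> \<in> \<Phi>" "x \<in> S" for \<phi> x
    by (rule bounded_by_scaling[where M = norm, OF N lin[OF that(1)] r])
      (use small[OF that(1)] that(2) in \<open>auto simp: norm_scaleC\<close>)
  then show ?thesis using r by (intro exI[of _ "2 * (2 * real n) / r"]) auto
qed

section \<open>The anti-dual as a normed space\<close>

lemma antidual_bounded: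
  assumes "norm_on S N" "\<phi> \<in> antidual_space S N"
  shows "\<exists>C\<ge>0. \<forall>x\<in>S. cmod (\<phi> x) \<le> C * N x"
proof -
  have "rlinear_on S \<phi>" "continuous_map (norm_topology S N) euclidean \<phi>"
    using assms(2) by (auto simp: antidual_space_def antilinear_on_imp_rlinear_on)
  then show ?thesis using continuous_functional_iff_bounded[OF assms(1)] by blast
qed

lemma antidualI:
  assumes "norm_on S N" "antilinear_on S \<phi>" "\<And>x. x \<notin> S \<Longrightarrow> \<phi> x = 0"
    and "C \<ge> 0" "\<And>x. x \<in> S \<Longrightarrow> cmod (\<phi> x) \<le> C * N x"
  shows "\<phi> \<in> antidual_space S N"
  using assms continuous_functional_iff_bounded[OF assms(1) antilinear_on_imp_rlinear_on[OF assms(2)]]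
  by (auto simp: antidual_space_def)

lemma dual_norm_upper:
  assumes N: "norm_on S N" and \<phi>: "\<phi> \<in> antidual_space S N" and x: "x \<in> S" "N x \<le> 1"
  shows "cmod (\<phi> x) \<le> dual_norm S N \<phi>"
proof -
  obtain C where C: "C \<ge> 0" "\<forall>x\<in>S. cmod (\<phi> x) \<le> C * N x" using antidual_bounded[OF N \<phi>] by blast
  have "bdd_above ((\<lambda>x. cmod (\<phi> x)) ` {x\<in>S. N x \<le> 1})"
  proof (rule bdd_aboveI2)
    fix y assume y: "y \<in> {x\<in>S. N x \<le> 1}"
    then have "C * N y \<le> C * 1" using C(1) by (intro mult_left_mono) auto
    then show "cmod (\<phi> y) \<le> C" using C(2) y by fastforce
  qed
  then show ?thesis
    unfolding dual_norm_def using x by (intro cSUP_upper) auto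
qed

lemma dual_norm_bound:
  assumes N: "norm_on S N" and \<phi>: "\<phi> \<in> antidual_space S N" and x: "x \<in> S"
  shows "cmod (\<phi> x) \<le> dual_norm S N \<phi> * N x"
proof (cases "x = 0")
  case True
  have "rlinear_on S \<phi>"
    using \<phi> by (auto simp: antidual_space_def antilinear_on_imp_rlinear_on)
  then have "\<phi> 0 = 0" using norm_onD(1)[OF N] by (rule rlinear_on_0)
  then show ?thesis using True norm_onD(3)[OF N x] by simp
next
  case False
  have pos: "N x > 0" using norm_onD(2,3)[OF N x] False by linarith
  define t where "t = complex_of_real (1 / N x)"
  have tx: "t *\<^sub>C x \<in> S" "N (t *\<^sub>C x) \<le> 1"
    using norm_onD(5)[OF N x, of t] pos complex_vector.subspace_scale[OF norm_onD(1)[OF N] x]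
    by (simp_all add: t_def norm_divide)
  have "cmod (\<phi> (t *\<^sub>C x)) \<le> dual_norm S N \<phi>"
    using tx dual_norm_upper[OF N \<phi>] by blast
  moreover have "\<phi> (t *\<^sub>C x) = cnj t * \<phi> x"
    using \<phi> x by (simp add: antidual_space_def antilinear_on_def scaleC_complex_def)
  then have "cmod (\<phi> (t *\<^sub>C x)) = cmod (\<phi> x) / N x"
    using pos by (simp add: norm_mult t_def norm_divide)
  ultimately show ?thesis
    using pos by (simp add: field_simps)
qed

lemma dual_norm_le:
  assumes N: "norm_on S N" and C: "C \<ge> 0" "\<And>x. x \<in> S \<Longrightarrow> cmod (\<phi> x) \<le> C * N x"
  shows "dual_norm S N \<phi> \<le> C"
  unfolding dual_norm_def
proof (rule cSUP_least)
  have "0 \<in> S" using norm_onD(1)[OF N] by (rule complex_vector.subspace_0)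
  then show "{x\<in>S. N x \<le> 1} \<noteq> {}" using norm_onD(3)[OF N, of 0] by force
next
  fix x assume "x \<in> {x\<in>S. N x \<le> 1}"
  moreover from this have "C * N x \<le> C * 1" using C(1) by (intro mult_left_mono) auto
  ultimately show "cmod (\<phi> x) \<le> C" using C(2)[of x] by simp
qed

theorem norm_on_antidual:
  assumes N: "norm_on S N"
  shows "norm_on (antidual_space S N) (dual_norm S N)"
proof -
  let ?S' = "antidual_space S N" and ?N' = "dual_norm S N"
  have anti: "antilinear_on S \<phi>" and off: "\<And>x. x \<notin> S \<Longrightarrow> \<phi> x = 0" if "\<phi> \<in> ?S'" for \<phi>
    using that by (auto simp: antidual_space_def)
  have nonneg: "0 \<le> ?N' \<phi>" if "\<phi> \<in> ?S'" for \<phi>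
  proof -
    have "0 \<in> S" using norm_onD(1)[OF N] by (rule complex_vector.subspace_0)
    then show ?thesis
      using dual_norm_upper[OF N that, of 0] norm_onD(3)[OF N, of 0]
      by (smt (verit) norm_ge_zero)
  qed
  have add: "\<phi> + \<psi> \<in> ?S' \<and> ?N' (\<phi> + \<psi>) \<le> ?N' \<phi> + ?N' \<psi>" if "\<phi> \<in> ?S'" "\<psi> \<in> ?S'" for \<phi> \<psi>
  proof -
    have bound: "cmod ((\<phi> + \<psi>) x) \<le> (?N' \<phi> + ?N' \<psi>) * N x" if "x \<in> S" for x
      using dual_norm_bound[OF N \<open>\<phi> \<in> ?S'\<close> that] dual_norm_bound[OF N \<open>\<psi> \<in> ?S'\<close> that]
        norm_triangle_ineq[of "\<phi> x" "\<psi> x"] by (simp add: distrib_right)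
    moreover have "antilinear_on S (\<phi> + \<psi>)"
      using anti[OF that(1)] anti[OF that(2)]
      by (simp add: antilinear_on_def scaleC_add_right)
    ultimately show ?thesis
      using nonneg[OF that(1)] nonneg[OF that(2)] off[OF that(1)] off[OF that(2)]
      by (auto intro!: antidualI[OF N, where C = "?N' \<phi> + ?N' \<psi>"] dual_norm_le[OF N])
  qed
  have scale: "c *\<^sub>C \<phi> \<in> ?S' \<and> ?N' (c *\<^sub>C \<phi>) \<le> cmod c * ?N' \<phi>" if "\<phi> \<in> ?S'" for c \<phi>
  proof -
    have "cmod ((c *\<^sub>C \<phi>) x) \<le> cmod c * ?N' \<phi> * N x" if "x \<in> S" for x
      using mult_left_mono[OF dual_norm_bound[OF N \<open>\<phi> \<in> ?S'\<close> that], of "cmod c"]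
      by (simp add: scaleC_fun_def scaleC_complex_def norm_mult mult.assoc)
    moreover have "antilinear_on S (c *\<^sub>C \<phi>)"
      using anti[OF that]
      by (simp add: antilinear_on_def scaleC_fun_def scaleC_complex_def distrib_left)
    ultimately show ?thesis
      using nonneg[OF that] off[OF that]
      by (auto simp: scaleC_fun_def intro!: antidualI[OF N, where C = "cmod c * ?N' \<phi>"] dual_norm_le[OF N])
  qed
  have scale_eq: "?N' (c *\<^sub>C \<phi>) = cmod c * ?N' \<phi>" if "\<phi> \<in> ?S'" for c \<phi>
  proof (cases "c = 0")
    case True
    then show ?thesis using scale[OF that, of c] nonneg[of "c *\<^sub>C \<phi>"] by auto
  next
    case False
    have "\<phi> = inverse c *\<^sub>C c *\<^sub>C \<phi>" using False by (simp add: scaleC_scaleC scaleC_one)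
    then have "?N' \<phi> \<le> cmod (inverse c) * ?N' (c *\<^sub>C \<phi>)"
      using scale[of "c *\<^sub>C \<phi>" "inverse c"] scale[OF that] by metis
    then have "cmod c * ?N' \<phi> \<le> ?N' (c *\<^sub>C \<phi>)"
      using False by (simp add: norm_divide norm_inverse field_simps)
    then show ?thesis using scale[OF that, of c] by linarith
  qed
  have zero: "0 \<in> ?S'"
    using norm_onD(2)[OF N]
    by (intro antidualI[OF N, where C = 0]) (auto simp: antilinear_on_def)
  have definite: "?N' \<phi> = 0 \<longleftrightarrow> \<phi> = 0" if "\<phi> \<in> ?S'" for \<phi>
  proof
    assume "?N' \<phi> = 0"
    then have "\<phi> x = 0" for x
      using dual_norm_bound[OF N that, of x] off[OF that, of x] by (cases "x \<in> S") auto
    then show "\<phi> = 0" by (simp add: fun_eq_iff)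
  next
    assume "\<phi> = 0"
    then show "?N' \<phi> = 0" using scale_eq[OF zero, of 0] by simp
  qed
  show ?thesis
    unfolding norm_on_def complex_vector.subspace_def
    using zero add scale scale_eq nonneg definite by blast
qed

section \<open>Operators, adjoints and resolvents\<close>

lemma linear_operatorD:
  assumes "linear_operator B"
  shows linear_operator_0: "(0, 0) \<in> B"
    and linear_operator_add: "(f, f') \<in> B \<Longrightarrow> (g, g') \<in> B \<Longrightarrow> (f + g, f' + g') \<in> B"
    and linear_operator_diff: "(f, f') \<in> B \<Longrightarrow> (g, g') \<in> B \<Longrightarrow> (f - g, f' - g') \<in> B"
    and linear_operator_scaleC: "(f, f') \<in> B \<Longrightarrow> (c *\<^sub>C f, c *\<^sub>C f') \<in> B"
    and op_app_eq: "(f, f') \<in> B \<Longrightarrow> op_app B f = f'"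
proof -
  have sub: "csubspace B" and sv: "single_valued B" using assms by (auto simp: linear_operator_def)
  show "(0, 0) \<in> B" using complex_vector.subspace_0[OF sub] by (simp add: zero_prod_def)
  show "(f + g, f' + g') \<in> B" if "(f, f') \<in> B" "(g, g') \<in> B"
    using complex_vector.subspace_add[OF sub that] by simp
  show "(f - g, f' - g') \<in> B" if "(f, f') \<in> B" "(g, g') \<in> B"
    using complex_vector.subspace_diff[OF sub that] by simp
  show "(c *\<^sub>C f, c *\<^sub>C f') \<in> B" if "(f, f') \<in> B"
    using complex_vector.subspace_scale[OF sub that] by (simp add: scaleC_prod_def)
  show "op_app B f = f'" if "(f, f') \<in> B"
    unfolding op_app_def using sv that by (auto simp: single_valued_def)
qed

lemma csubspace_Domain:
  assumes "linear_operator B" shows "csubspace (Domain B)"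
  unfolding complex_vector.subspace_def Domain_iff
  using linear_operatorD[OF assms] by blast

lemma graph_norm_eq: "linear_operator B \<Longrightarrow> (f, f') \<in> B \<Longrightarrow> graph_norm B f = norm (f, f')"
  by (simp add: graph_norm_def op_app_eq norm_Pair)

lemma norm_Pair_scaleC:
  "norm (c *\<^sub>C f, c *\<^sub>C f') = cmod c * norm (f :: 'a::complex_inner, f' :: 'b::complex_inner)"
proof -
  have "(cmod c * norm f)\<^sup>2 + (cmod c * norm f')\<^sup>2 = (cmod c)\<^sup>2 * ((norm f)\<^sup>2 + (norm f')\<^sup>2)"
    by (simp add: power_mult_distrib distrib_left)
  then show ?thesis by (simp add: norm_Pair norm_scaleC real_sqrt_mult)
qed

lemma norm_on_graph_norm:
  fixes B :: "'h::complex_inner operator"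
  assumes B: "linear_operator B"
  shows "norm_on (Domain B) (graph_norm B)"
  unfolding norm_on_def
proof (intro conjI ballI allI)
  show "csubspace (Domain B)" by (rule csubspace_Domain[OF B])
next
  fix f assume "f \<in> Domain B"
  then obtain f' where f: "(f, f') \<in> B" by blast
  show "0 \<le> graph_norm B f" by (simp add: graph_norm_def)
  show "graph_norm B f = 0 \<longleftrightarrow> f = 0"
    using graph_norm_eq[OF B f] op_app_eq[OF B f] op_app_eq[OF B linear_operator_0[OF B]]
    by (auto simp: zero_prod_def)
next
  fix f g assume "f \<in> Domain B" "g \<in> Domain B"
  then obtain f' g' where f: "(f, f') \<in> B" and g: "(g, g') \<in> B" by blast
  show "graph_norm B (f + g) \<le> graph_norm B f + graph_norm B g"
    using norm_triangle_ineq[of "(f, f')" "(g, g')"]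
    by (simp add: graph_norm_eq[OF B f] graph_norm_eq[OF B g]
        graph_norm_eq[OF B linear_operator_add[OF B f g]])
next
  fix c f assume "f \<in> Domain B"
  then obtain f' where f: "(f, f') \<in> B" by blast
  show "graph_norm B (c *\<^sub>C f) = cmod c * graph_norm B f"
    by (simp add: graph_norm_eq[OF B f] graph_norm_eq[OF B linear_operator_scaleC[OF B f]]
        norm_Pair_scaleC)
qed

lemma Domain_dense_if_graph_dense:
  fixes B T :: "'h::complex_inner operator"
  assumes B: "linear_operator B" and T: "T \<subseteq> B" "B \<subseteq> closure T"
  shows "Domain B \<subseteq> norm_topology (Domain B) (graph_norm B) closure_of Domain T"
proof
  interpret Metric_space "Domain B" "norm_dist (Domain B) (graph_norm B)"
    by (rule Metric_space_norm_dist[OF norm_on_graph_norm[OF B]])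
  fix f assume f_dom: "f \<in> Domain B"
  then obtain f' where f: "(f, f') \<in> B" by blast
  have "\<exists>g\<in>Domain T. g \<in> mball f r" if r: "r > 0" for r
  proof -
    obtain p where "p \<in> T" "dist p (f, f') < r"
      using f T(2) r by (meson closure_approachable subsetD)
    then obtain g g' where g: "(g, g') \<in> T" "norm ((f, f') - (g, g')) < r"
      by (metis dist_commute dist_norm surj_pair)
    then have gB: "(g, g') \<in> B" using T(1) by blast
    have "graph_norm B (f - g) < r"
      using g(2) graph_norm_eq[OF B linear_operator_diff[OF B f gB]] by simp
    then show ?thesis using g(1) gB f_dom by (force simp: norm_dist_def)
  qed
  then show "f \<in> norm_topology (Domain B) (graph_norm B) closure_of Domain T"
    unfolding norm_topology_def metric_closure_of using f_dom by blast
qed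

lemma cinner_left_cancel_dense:
  fixes y z :: "'a::complex_inner"
  assumes "closure X = UNIV" "\<And>x. x \<in> X \<Longrightarrow> cinner x y = cinner x z"
  shows "y = z"
proof (rule cinner_left_cancel)
  have "closed {x. cinner x y = cinner x z}"
    by (intro closed_Collect_eq cinner.continuous_on continuous_intros)
  then have "closure X \<subseteq> {x. cinner x y = cinner x z}"
    using assms(2) by (intro closure_minimal) auto
  then show "cinner x y = cinner x z" for x using assms(1) by blast
qed

lemma linear_operator_adjoint:
  assumes "densely_defined B"
  shows "linear_operator (adjoint_op B)"
proof -
  have "single_valued (adjoint_op B)"
  proof (rule single_valuedI)
    fix g g1 g2 assume "(g, g1) \<in> adjoint_op B" "(g, g2) \<in> adjoint_op B"
    then have "cinner f g1 = cinner f g2" if "f \<in> Domain B" for f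
      using that by (fastforce simp: adjoint_op_def)
    then show "g1 = g2"
      using assms cinner_left_cancel_dense unfolding densely_defined_def by blast
  qed
  moreover have "csubspace (adjoint_op B)"
    unfolding complex_vector.subspace_def
  proof (intro conjI ballI allI)
    show "0 \<in> adjoint_op B" by (auto simp: adjoint_op_def zero_prod_def cinner.zero_right)
  next
    fix p q assume "p \<in> adjoint_op B" "q \<in> adjoint_op B"
    then show "p + q \<in> adjoint_op B"
      by (cases p; cases q) (fastforce simp: adjoint_op_def cinner_add_right)
  next
    fix c p assume "p \<in> adjoint_op B"
    then show "c *\<^sub>C p \<in> adjoint_op B"
      by (cases p) (fastforce simp: adjoint_op_def scaleC_prod_def cinner_scaleC_right)
  qed
  ultimately show ?thesis by (simp add: linear_operator_def)
qed

context
  fixes B :: "'h::complex_inner operator" and z :: complex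
  assumes B: "linear_operator B" and z: "z \<in> resolvent_set B"
begin

lemma resolvent_eq: "(f, f') \<in> B \<Longrightarrow> resolvent B z (f' - z *\<^sub>C f) = f"
proof -
  assume "(f, f') \<in> B"
  then have "(f' - z *\<^sub>C f, f) \<in> (op_minus_scalar B z)\<inverse>" by (auto simp: op_minus_scalar_def)
  moreover have "single_valued ((op_minus_scalar B z)\<inverse>)" using z by (simp add: resolvent_set_def)
  ultimately show ?thesis
    unfolding resolvent_def op_app_def by (auto simp: single_valued_def)
qed

lemma resolvent_graph: "(resolvent B z h, h + z *\<^sub>C resolvent B z h) \<in> B"
proof -
  have "h \<in> Range (op_minus_scalar B z)" using z by (simp add: resolvent_set_def)
  then obtain f f' where f: "(f, f') \<in> B" "h = f' - z *\<^sub>C f" by (auto simp: op_minus_scalar_def)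
  then show ?thesis using resolvent_eq[OF f(1)] by simp
qed

lemma clinear_resolvent: "clinear_on UNIV (resolvent B z)"
  unfolding clinear_on_def
proof (intro conjI ballI allI)
  fix h k :: 'h and c :: complex
  show "resolvent B z (h + k) = resolvent B z h + resolvent B z k"
    using resolvent_eq[OF linear_operator_add[OF B resolvent_graph[of h] resolvent_graph[of k]]]
    by (simp add: scaleC_add_right algebra_simps)
  show "resolvent B z (c *\<^sub>C h) = c *\<^sub>C resolvent B z h"
    using resolvent_eq[OF linear_operator_scaleC[OF B resolvent_graph[of h], of c]]
    by (simp add: scaleC_add_right scaleC_scaleC mult.commute)
qed

lemma resolvent_bounded: "\<exists>C\<ge>0. \<forall>h. norm (resolvent B z h) \<le> C * norm h"
  using continuous_functional_iff_bounded[OF norm_on_UNIV clinear_on_imp_rlinear_on[OF clinear_resolvent]]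
    z by (simp add: norm_topology_UNIV resolvent_set_def)

end

lemma resolvent_identity:
  assumes "linear_operator B" "z \<in> resolvent_set B" "w \<in> resolvent_set B"
  shows "resolvent B w h = resolvent B z (h + (w - z) *\<^sub>C resolvent B w h)"
  using resolvent_eq[OF assms(1,2) resolvent_graph[OF assms(1,3), of h]]
  by (simp add: complex_vector.scale_left_diff_distrib algebra_simps)

text \<open>
  The adjoint of the bounded operator \<open>(B - z)\<inverse>\<close>, supplied by the Riesz representation,
  inverts \<open>B - cnj z\<close>.
\<close>

lemma resolvent_set_cnj:
  fixes B :: "'h::chilbert_space operator"
  assumes sa: "self_adjoint B" and z: "z \<in> resolvent_set B"
  shows "cnj z \<in> resolvent_set B"
proof -
  have B: "linear_operator B" and adj: "adjoint_op B = B"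
    using sa by (auto simp: self_adjoint_def)
  have sym: "cinner f' g = cinner f g'" if "(f, f') \<in> B" "(g, g') \<in> B" for f f' g g'
    using that adj unfolding adjoint_op_def by blast
  obtain C where C: "C \<ge> 0" "\<And>h. norm (resolvent B z h) \<le> C * norm h"
    using resolvent_bounded[OF B z] by blast
  have ex: "\<exists>g. (g, h + cnj z *\<^sub>C g) \<in> B \<and> norm g \<le> C * norm h" for h
  proof -
    have "clinear_on UNIV (\<lambda>k. cinner (resolvent B z k) h)"
      using clinear_resolvent[OF B z]
      by (simp add: clinear_on_def cinner_add_left cinner_scaleC_left scaleC_complex_def)
    moreover have "cmod (cinner (resolvent B z k) h) \<le> (C * norm h) * norm k" for k
      using Cauchy_Schwarz[of "resolvent B z k" h] mult_right_mono[OF C(2)[of k] norm_ge_zero[of h]]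
      by (simp add: ac_simps)
    ultimately obtain g where g: "\<And>k. cinner (resolvent B z k) h = cinner k g"
      using Riesz_representation[of "\<lambda>k. cinner (resolvent B z k) h" "C * norm h"] by blast
    have "cinner f' g = cinner f (h + cnj z *\<^sub>C g)" if f: "(f, f') \<in> B" for f f'
      using g[of "f' - z *\<^sub>C f"] resolvent_eq[OF B z f]
      by (simp add: cinner.diff_left cinner_scaleC_left cinner_add_right cinner_scaleC_right)
    then have "(g, h + cnj z *\<^sub>C g) \<in> adjoint_op B" by (auto simp: adjoint_op_def)
    moreover have "norm g \<le> C * norm h"
    proof (cases "g = 0")
      case False
      have "complex_of_real ((norm g)\<^sup>2) = cinner (resolvent B z g) h"
        by (simp only: g cinner_self)
      then have "(norm g)\<^sup>2 = cmod (cinner (resolvent B z g) h)"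
        by (metis abs_of_nonneg norm_of_real zero_le_power2)
      also have "\<dots> \<le> norm (resolvent B z g) * norm h" by (rule Cauchy_Schwarz)
      also have "\<dots> \<le> C * norm g * norm h" by (intro mult_right_mono C(2)) simp
      finally have "norm g * norm g \<le> (C * norm h) * norm g"
        by (simp add: power2_eq_square ac_simps)
      then show ?thesis using False by simp
    qed (simp add: C(1))
    ultimately show ?thesis using adj by auto
  qed
  have kernel: "f = 0" if f: "(f, cnj z *\<^sub>C f) \<in> B" for f
  proof (rule cinner_left_cancel)
    fix h
    have "cinner (h + z *\<^sub>C resolvent B z h) f = cinner (resolvent B z h) (cnj z *\<^sub>C f)"
      by (rule sym[OF resolvent_graph[OF B z] f])
    then show "cinner h f = cinner h 0"
      by (simp add: cinner_add_left cinner_scaleC_left cinner_scaleC_right cinner.zero_right)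
  qed
  have sv: "single_valued ((op_minus_scalar B (cnj z))\<inverse>)"
  proof (rule single_valuedI)
    fix h f g assume "(h, f) \<in> (op_minus_scalar B (cnj z))\<inverse>" "(h, g) \<in> (op_minus_scalar B (cnj z))\<inverse>"
    then obtain f' g' where f: "(f, f') \<in> B" "h = f' - cnj z *\<^sub>C f"
      and g: "(g, g') \<in> B" "h = g' - cnj z *\<^sub>C g" by (auto simp: op_minus_scalar_def)
    have "f' - g' = cnj z *\<^sub>C (f - g)"
      using f(2) g(2) by (simp add: complex_vector.scale_right_diff_distrib algebra_simps)
    then have "f - g = 0" using kernel linear_operator_diff[OF B f(1) g(1)] by metis
    then show "f = g" by simp
  qed
  have inv: "(h, g) \<in> (op_minus_scalar B (cnj z))\<inverse>" if "(g, h + cnj z *\<^sub>C g) \<in> B" for g h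
    using that by (force simp: op_minus_scalar_def)
  have res: "resolvent B (cnj z) h = g" if "(g, h + cnj z *\<^sub>C g) \<in> B" for g h
    unfolding resolvent_def op_app_def using inv[OF that] sv by (auto simp: single_valued_def)
  have range: "Range (op_minus_scalar B (cnj z)) = UNIV" using ex inv by blast
  have bound: "norm (resolvent B (cnj z) h) \<le> C * norm h" for h using ex[of h] res by metis
  have graph: "(resolvent B (cnj z) h, h + cnj z *\<^sub>C resolvent B (cnj z) h) \<in> B" for h
    using ex[of h] res by metis
  have "clinear_on UNIV (resolvent B (cnj z))"
    unfolding clinear_on_def
  proof (intro conjI ballI allI)
    fix h k :: 'h and c :: complex
    show "resolvent B (cnj z) (h + k) = resolvent B (cnj z) h + resolvent B (cnj z) k"
      using linear_operator_add[OF B graph[of h] graph[of k]]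
      by (intro res) (simp add: scaleC_add_right ac_simps)
    show "resolvent B (cnj z) (c *\<^sub>C h) = c *\<^sub>C resolvent B (cnj z) h"
      using linear_operator_scaleC[OF B graph[of h], of c]
      by (intro res) (simp add: scaleC_add_right scaleC_scaleC mult.commute)
  qed
  then have "continuous_map euclidean euclidean (resolvent B (cnj z))"
    using continuous_functional_iff_bounded[OF norm_on_UNIV clinear_on_imp_rlinear_on] bound C(1)
    unfolding norm_topology_UNIV by blast
  then show ?thesis using sv range by (simp add: resolvent_set_def)
qed

section \<open>The extended boundary map\<close>

locale boundary_setting =
  fixes A T A1 :: "('h::chilbert_space) operator"
    and \<Gamma>0 \<Gamma>1 :: "'h \<Rightarrow> 'g::chilbert_space"
    and G0 :: "'g set" and N :: "'g \<Rightarrow> real"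
  assumes dense: "densely_defined A"
    and triple: "quasi_boundary_triple A T \<Gamma>0 \<Gamma>1"
    and A1_def: "A1 = op_restrict T (ker_on (Domain T) \<Gamma>1)"
    and A1_sa: "self_adjoint A1"
    and G0_def: "G0 = \<Gamma>0 ` ker_on (Domain T) \<Gamma>1"
    and banach: "banach_on G0 N"
    and embedding: "continuous_map (norm_topology G0 N) euclidean (\<lambda>x. x)"
begin

lemma T_linear: "linear_operator T" and T_sub: "T \<subseteq> adjoint_op A"
  and T_closure: "closure T = adjoint_op A"
  and \<Gamma>0_linear: "clinear_on (Domain T) \<Gamma>0"
  and A0_sa: "self_adjoint (op_restrict T (ker_on (Domain T) \<Gamma>0))"
  using triple by (auto simp: quasi_boundary_triple_def)

lemma Astar_linear: "linear_operator (adjoint_op A)"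
  by (rule linear_operator_adjoint[OF dense])

lemma A1_linear: "linear_operator A1"
  using A1_sa by (simp add: self_adjoint_def)

lemma in_A1: "(u, u') \<in> A1 \<longleftrightarrow> (u, u') \<in> T \<and> \<Gamma>1 u = 0"
  by (auto simp: A1_def op_restrict_def ker_on_def)

lemma N_norm: "norm_on G0 N"
  using banach by (simp add: banach_on_def)

lemma G0_subspace: "csubspace G0"
  by (rule norm_onD(1)[OF N_norm])

lemma \<Gamma>0_in_G0: "(u, u') \<in> A1 \<Longrightarrow> \<Gamma>0 u \<in> G0"
  by (auto simp: in_A1 G0_def ker_on_def)

lemma G0_cases:
  assumes "x \<in> G0"
  obtains u u' where "(u, u') \<in> A1" "x = \<Gamma>0 u"
  using assms by (auto simp: in_A1 G0_def ker_on_def)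

lemma \<Gamma>0_add: "(u, u') \<in> T \<Longrightarrow> (v, v') \<in> T \<Longrightarrow> \<Gamma>0 (u + v) = \<Gamma>0 u + \<Gamma>0 v"
  and \<Gamma>0_scaleC: "(u, u') \<in> T \<Longrightarrow> \<Gamma>0 (c *\<^sub>C u) = c *\<^sub>C \<Gamma>0 u"
  using \<Gamma>0_linear unfolding clinear_on_def by (meson DomainI)+

lemma \<Gamma>0_diff:
  assumes "(u, u') \<in> T" "(v, v') \<in> T"
  shows "\<Gamma>0 (u - v) = \<Gamma>0 u - \<Gamma>0 v"
  using rlinear_on_diff[OF clinear_on_imp_rlinear_on[OF \<Gamma>0_linear] csubspace_Domain[OF T_linear]]
    assms by blast

lemma Green_ker_\<Gamma>1:
  assumes f: "(f, f') \<in> T" and u: "(u, u') \<in> A1"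
  shows "cinner f' u - cinner f u' = cinner (\<Gamma>1 f) (\<Gamma>0 u)"
proof -
  have uT: "(u, u') \<in> T" "\<Gamma>1 u = 0" using u by (auto simp: in_A1)
  have "cinner (op_app T f) u - cinner f (op_app T u) = cinner (\<Gamma>1 f) (\<Gamma>0 u) - cinner (\<Gamma>0 f) (\<Gamma>1 u)"
    using triple f uT unfolding quasi_boundary_triple_def by blast
  then show ?thesis
    by (simp add: op_app_eq[OF T_linear f] op_app_eq[OF T_linear uT(1)] uT(2) cinner.zero_right)
qed

text \<open>
  Both sides depend continuously on the point \<open>(f, f')\<close> of the graph, so that the case of the
  graph \<open>T\<close>, where Green's identity applies, carries over to its closure. Consequently
  \<open>(f', u) - (f, u')\<close> depends on \<open>u\<close> through \<open>\<Gamma>0 u\<close> alone.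
\<close>

lemma Green_vanishes:
  assumes f: "(f, f') \<in> adjoint_op A" and u: "(u, u') \<in> A1" "\<Gamma>0 u = 0"
  shows "cinner f' u = cinner f u'"
proof -
  let ?S = "{p. cinner (snd p) u = cinner (fst p) u'}"
  have "closed ?S" by (intro closed_Collect_eq cinner.continuous_on continuous_intros)
  moreover have "T \<subseteq> ?S" using Green_ker_\<Gamma>1[OF _ u(1)] u(2) by (auto simp: cinner.zero_right)
  ultimately have "adjoint_op A \<subseteq> ?S" using closure_minimal T_closure by blast
  then show ?thesis using f by auto
qed

text \<open>
  Any \<open>u \<in> ker \<Gamma>1\<close> with \<open>\<Gamma>0 u = x\<close> gives the same value, so that the choice is immaterial. The
  value \<open>0\<close> off \<open>G0\<close> makes the function a member of \<^const>\<open>antidual_space\<close>.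
\<close>

definition \<Gamma>1_ext :: "'h \<Rightarrow> 'g \<Rightarrow> complex" where
  "\<Gamma>1_ext f x = (if x \<in> G0
     then let (u, u') = SOME p. p \<in> A1 \<and> \<Gamma>0 (fst p) = x
          in cinner (op_app (adjoint_op A) f) u - cinner f u'
     else 0)"

lemma \<Gamma>1_ext_off: "x \<notin> G0 \<Longrightarrow> \<Gamma>1_ext f x = 0"
  by (simp add: \<Gamma>1_ext_def)

lemma \<Gamma>1_ext_\<Gamma>0:
  assumes f: "(f, f') \<in> adjoint_op A" and u: "(u, u') \<in> A1"
  shows "\<Gamma>1_ext f (\<Gamma>0 u) = cinner f' u - cinner f u'"
proof -
  obtain v v' where v: "(SOME p. p \<in> A1 \<and> \<Gamma>0 (fst p) = \<Gamma>0 u) = (v, v')" by fastforce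
  have "(u, u') \<in> A1 \<and> \<Gamma>0 (fst (u, u')) = \<Gamma>0 u" using u by simp
  then have vA1: "(v, v') \<in> A1" and v\<Gamma>: "\<Gamma>0 v = \<Gamma>0 u"
    using someI[of "\<lambda>p. p \<in> A1 \<and> \<Gamma>0 (fst p) = \<Gamma>0 u"] unfolding v by fastforce+
  have "\<Gamma>0 (v - u) = 0" using \<Gamma>0_diff v\<Gamma> vA1 u by (auto simp: in_A1)
  then have "cinner f' (v - u) = cinner f (v' - u')"
    by (rule Green_vanishes[OF f linear_operator_diff[OF A1_linear vA1 u]])
  then show ?thesis
    using \<Gamma>0_in_G0[OF u] v op_app_eq[OF Astar_linear f]
    by (simp add: \<Gamma>1_ext_def cinner.diff_right algebra_simps)
qed

lemma \<Gamma>1_ext_eq_\<Gamma>1: "f \<in> Domain T \<Longrightarrow> \<Gamma>1_ext f = to_antidual G0 (\<Gamma>1 f)"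
proof
  fix x assume "f \<in> Domain T"
  then obtain f' where f: "(f, f') \<in> T" by blast
  show "\<Gamma>1_ext f x = to_antidual G0 (\<Gamma>1 f) x"
  proof (cases "x \<in> G0")
    case True
    then obtain u u' where u: "(u, u') \<in> A1" "x = \<Gamma>0 u" by (rule G0_cases)
    then show ?thesis
      using \<Gamma>1_ext_\<Gamma>0 f T_sub Green_ker_\<Gamma>1[OF f u(1)] True by (auto simp: to_antidual_def)
  qed (simp add: \<Gamma>1_ext_off to_antidual_def)
qed

lemma \<Gamma>1_ext_antilinear:
  assumes "f \<in> Domain (adjoint_op A)"
  shows "antilinear_on G0 (\<Gamma>1_ext f)"
proof -
  obtain f' where f: "(f, f') \<in> adjoint_op A" using assms by blast
  show ?thesis
    unfolding antilinear_on_def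
  proof (intro conjI ballI allI)
    fix x y assume "x \<in> G0" "y \<in> G0"
    then obtain u u' v v' where u: "(u, u') \<in> A1" "x = \<Gamma>0 u" and v: "(v, v') \<in> A1" "y = \<Gamma>0 v"
      by (metis G0_cases)
    have "x + y = \<Gamma>0 (u + v)" using \<Gamma>0_add u v by (auto simp: in_A1)
    then show "\<Gamma>1_ext f (x + y) = \<Gamma>1_ext f x + \<Gamma>1_ext f y"
      using \<Gamma>1_ext_\<Gamma>0[OF f linear_operator_add[OF A1_linear u(1) v(1)]] \<Gamma>1_ext_\<Gamma>0[OF f u(1)] \<Gamma>1_ext_\<Gamma>0[OF f v(1)]
      by (simp add: u v cinner_add_right)
  next
    fix c x assume "x \<in> G0"
    then obtain u u' where u: "(u, u') \<in> A1" "x = \<Gamma>0 u" by (rule G0_cases)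
    have "c *\<^sub>C x = \<Gamma>0 (c *\<^sub>C u)" using \<Gamma>0_scaleC u by (auto simp: in_A1)
    then show "\<Gamma>1_ext f (c *\<^sub>C x) = cnj c *\<^sub>C \<Gamma>1_ext f x"
      using \<Gamma>1_ext_\<Gamma>0[OF f linear_operator_scaleC[OF A1_linear u(1)], of c] \<Gamma>1_ext_\<Gamma>0[OF f u(1)]
      by (simp add: u cinner_scaleC_right scaleC_complex_def right_diff_distrib)
  qed
qed

lemma \<Gamma>1_ext_linear: "clinear_on (Domain (adjoint_op A)) \<Gamma>1_ext"
  unfolding clinear_on_def
proof (intro conjI ballI allI ext)
  fix f g x assume "f \<in> Domain (adjoint_op A)" "g \<in> Domain (adjoint_op A)"
  then obtain f' g' where f: "(f, f') \<in> adjoint_op A" and g: "(g, g') \<in> adjoint_op A" by blast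
  show "\<Gamma>1_ext (f + g) x = (\<Gamma>1_ext f + \<Gamma>1_ext g) x"
  proof (cases "x \<in> G0")
    case True
    then obtain u u' where u: "(u, u') \<in> A1" "x = \<Gamma>0 u" by (rule G0_cases)
    then show ?thesis
      using \<Gamma>1_ext_\<Gamma>0[OF f u(1)] \<Gamma>1_ext_\<Gamma>0[OF g u(1)] \<Gamma>1_ext_\<Gamma>0[OF linear_operator_add[OF Astar_linear f g] u(1)]
      by (simp add: cinner_add_left)
  qed (simp add: \<Gamma>1_ext_off)
next
  fix c f x assume "f \<in> Domain (adjoint_op A)"
  then obtain f' where f: "(f, f') \<in> adjoint_op A" by blast
  show "\<Gamma>1_ext (c *\<^sub>C f) x = (c *\<^sub>C \<Gamma>1_ext f) x"
  proof (cases "x \<in> G0")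
    case True
    then obtain u u' where u: "(u, u') \<in> A1" "x = \<Gamma>0 u" by (rule G0_cases)
    then show ?thesis
      using \<Gamma>1_ext_\<Gamma>0[OF f u(1)] \<Gamma>1_ext_\<Gamma>0[OF linear_operator_scaleC[OF Astar_linear f, of c] u(1)]
      by (simp add: scaleC_fun_def scaleC_complex_def cinner_scaleC_left right_diff_distrib)
  qed (simp add: \<Gamma>1_ext_off scaleC_fun_def scaleC_complex_def)
qed

text \<open>
  Green's identity bounds the functionals \<open>\<Gamma>1_ext f\<close> with \<open>f\<close> in the unit ball of \<open>dom T\<close>
  pointwise on \<open>G0\<close>; each of them is continuous because \<open>G0\<close> is continuously embedded in the
  boundary space. The Banach-Steinhaus theorem makes the bound uniform, and density of \<open>T\<close> in
  the graph of \<open>A\<^sup>*\<close> extends it.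
\<close>

lemma \<Gamma>1_ext_bounded:
  "\<exists>C\<ge>0. \<forall>(f, f') \<in> adjoint_op A. \<forall>x\<in>G0. cmod (\<Gamma>1_ext f x) \<le> C * norm (f, f') * N x"
proof -
  define \<Phi> where "\<Phi> = {\<Gamma>1_ext f | f f'. (f, f') \<in> T \<and> norm (f, f') < 1}"
  have "rlinear_on G0 (\<lambda>x. x)" by (simp add: rlinear_on_def)
  then obtain K where K: "K \<ge> 0" "\<And>x. x \<in> G0 \<Longrightarrow> norm x \<le> K * N x"
    using continuous_functional_iff_bounded[OF N_norm] embedding by blast
  have "\<exists>C\<ge>0. \<forall>\<phi>\<in>\<Phi>. \<forall>x\<in>G0. norm (\<phi> x) \<le> C * N x"
  proof (rule Banach_Steinhaus[OF banach])
    fix \<phi> assume "\<phi> \<in> \<Phi>"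
    then obtain f f' where f: "(f, f') \<in> T" "\<phi> = \<Gamma>1_ext f" by (auto simp: \<Phi>_def)
    show lin: "rlinear_on G0 \<phi>"
      using \<Gamma>1_ext_antilinear[of f] f T_sub by (auto intro: antilinear_on_imp_rlinear_on)
    have "norm (\<phi> x) \<le> norm (\<Gamma>1 f) * K * N x" if "x \<in> G0" for x
    proof -
      have "\<phi> x = cinner (\<Gamma>1 f) x"
        using that \<Gamma>1_ext_eq_\<Gamma>1[OF DomainI[OF f(1)]] f(2) by (simp add: to_antidual_def)
      then have "norm (\<phi> x) \<le> norm (\<Gamma>1 f) * norm x" by (simp add: Cauchy_Schwarz)
      also have "\<dots> \<le> norm (\<Gamma>1 f) * (K * N x)" by (intro mult_left_mono K(2) that) simp
      finally show ?thesis by (simp add: mult.assoc)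
    qed
    then show "continuous_map (norm_topology G0 N) euclidean \<phi>"
      unfolding continuous_functional_iff_bounded[OF N_norm lin] using K(1)
      by (intro exI[of _ "norm (\<Gamma>1 f) * K"]) auto
  next
    fix x assume "x \<in> G0"
    then obtain u u' where u: "(u, u') \<in> A1" "x = \<Gamma>0 u" by (rule G0_cases)
    have "norm (\<Gamma>1_ext f x) \<le> norm u + norm u'" if f: "(f, f') \<in> T" "norm (f, f') < 1" for f f'
    proof -
      have "norm f \<le> 1" "norm f' \<le> 1"
        using norm_fst_le[of f f'] norm_snd_le[of f' f] f(2) by linarith+
      then have "norm f' * norm u \<le> 1 * norm u" "norm f * norm u' \<le> 1 * norm u'"
        by (intro mult_right_mono; simp)+
      moreover have "\<Gamma>1_ext f x = cinner f' u - cinner f u'"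
        unfolding u(2) using f(1) T_sub by (intro \<Gamma>1_ext_\<Gamma>0[OF _ u(1)]) auto
      then have "norm (\<Gamma>1_ext f x) \<le> cmod (cinner f' u) + cmod (cinner f u')"
        by (simp add: norm_triangle_ineq4)
      ultimately show ?thesis
        using Cauchy_Schwarz[of f' u] Cauchy_Schwarz[of f u'] by linarith
    qed
    then show "\<exists>C. \<forall>\<phi>\<in>\<Phi>. norm (\<phi> x) \<le> C"
      by (auto simp: \<Phi>_def)
  qed
  then obtain C where C: "C \<ge> 0" "\<And>\<phi> x. \<phi> \<in> \<Phi> \<Longrightarrow> x \<in> G0 \<Longrightarrow> norm (\<phi> x) \<le> C * N x"
    by blast
  have on_T: "cmod (\<Gamma>1_ext f x) \<le> 2 * C * norm (f, f') * N x" if f: "(f, f') \<in> T" and x: "x \<in> G0" for f f' x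
  proof -
    have "rlinear_on (Domain T) (\<lambda>f. \<Gamma>1_ext f x)"
      unfolding rlinear_on_def
    proof (intro conjI ballI allI)
      fix f g assume "f \<in> Domain T" "g \<in> Domain T"
      then have "f \<in> Domain (adjoint_op A)" "g \<in> Domain (adjoint_op A)" using T_sub by auto
      then show "\<Gamma>1_ext (f + g) x = \<Gamma>1_ext f x + \<Gamma>1_ext g x" using \<Gamma>1_ext_linear by (simp add: clinear_on_def)
    next
      fix r f assume "f \<in> Domain T"
      then have "f \<in> Domain (adjoint_op A)" using T_sub by auto
      then show "\<Gamma>1_ext (complex_of_real r *\<^sub>C f) x = complex_of_real r *\<^sub>C \<Gamma>1_ext f x"
        using \<Gamma>1_ext_linear by (simp add: clinear_on_def scaleC_fun_def)
    qed
    moreover have "cmod (\<Gamma>1_ext g x) \<le> C * N x" if "g \<in> Domain T" "graph_norm T g < 1" for g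
      using that C(2)[OF _ x] graph_norm_eq[OF T_linear] by (fastforce simp: \<Phi>_def)
    ultimately have "cmod (\<Gamma>1_ext f x) \<le> 2 * (C * N x) / 1 * graph_norm T f"
      using f by (intro bounded_by_scaling[where M = cmod, OF norm_on_graph_norm[OF T_linear]])
        (auto simp: scaleC_complex_def norm_mult)
    then show ?thesis by (simp add: graph_norm_eq[OF T_linear f] ac_simps)
  qed
  have "cmod (\<Gamma>1_ext f x) \<le> 2 * C * norm (f, f') * N x"
    if f: "(f, f') \<in> adjoint_op A" and x: "x \<in> G0" for f f' x
  proof -
    obtain u u' where u: "(u, u') \<in> A1" "x = \<Gamma>0 u" using x by (rule G0_cases)
    let ?S = "{p. cmod (cinner (snd p) u - cinner (fst p) u') \<le> 2 * C * norm p * N x}"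
    have "closed ?S"
      by (intro closed_Collect_le continuous_intros cinner.continuous_on)
    moreover have "T \<subseteq> ?S"
    proof
      fix p assume "p \<in> T"
      then obtain g g' where g: "p = (g, g')" "(g, g') \<in> T" by (cases p) auto
      then show "p \<in> ?S" using on_T[OF g(2) x] \<Gamma>1_ext_\<Gamma>0[OF _ u(1), of g g'] T_sub u(2) by auto
    qed
    ultimately have "adjoint_op A \<subseteq> ?S" using closure_minimal T_closure by blast
    then show ?thesis using f \<Gamma>1_ext_\<Gamma>0[OF f u(1)] u(2) by auto
  qed
  then show ?thesis using C(1) by (intro exI[of _ "2 * C"]) auto
qed

theorem \<Gamma>1_ext_continuous:
  shows "\<Gamma>1_ext ` Domain (adjoint_op A) \<subseteq> antidual_space G0 N"
    and "continuous_map (norm_topology (Domain (adjoint_op A)) (graph_norm (adjoint_op A)))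
      (norm_topology (antidual_space G0 N) (dual_norm G0 N)) \<Gamma>1_ext"
proof -
  obtain C where C: "C \<ge> 0" and bound: "\<And>f f' x. (f, f') \<in> adjoint_op A \<Longrightarrow> x \<in> G0 \<Longrightarrow>
      cmod (\<Gamma>1_ext f x) \<le> C * norm (f, f') * N x"
    using \<Gamma>1_ext_bounded by blast
  show im: "\<Gamma>1_ext ` Domain (adjoint_op A) \<subseteq> antidual_space G0 N"
  proof (rule image_subsetI)
    fix f assume f: "f \<in> Domain (adjoint_op A)"
    then obtain f' where "(f, f') \<in> adjoint_op A" by blast
    from bound[OF this] show "\<Gamma>1_ext f \<in> antidual_space G0 N"
      using C by (intro antidualI[OF N_norm \<Gamma>1_ext_antilinear[OF f], where C = "C * norm (f, f')"])
        (auto simp: \<Gamma>1_ext_off)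
  qed
  have "dual_norm G0 N (\<Gamma>1_ext f) \<le> C * graph_norm (adjoint_op A) f" if "f \<in> Domain (adjoint_op A)" for f
  proof -
    obtain f' where f: "(f, f') \<in> adjoint_op A" using \<open>f \<in> _\<close> by blast
    show ?thesis
      unfolding graph_norm_eq[OF Astar_linear f]
      using C bound[OF f] by (intro dual_norm_le[OF N_norm]) auto
  qed
  then show "continuous_map (norm_topology (Domain (adjoint_op A)) (graph_norm (adjoint_op A)))
      (norm_topology (antidual_space G0 N) (dual_norm G0 N)) \<Gamma>1_ext"
    using continuous_iff_bounded[OF norm_on_graph_norm[OF Astar_linear] norm_on_antidual[OF N_norm]
        clinear_on_imp_rlinear_on[OF \<Gamma>1_ext_linear] im] C by blast
qed

lemma continuous_extension_unique:
  assumes F: "continuous_map (norm_topology (Domain (adjoint_op A)) (graph_norm (adjoint_op A)))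
      (norm_topology (antidual_space G0 N) (dual_norm G0 N)) F"
    and eq: "\<And>f. f \<in> Domain T \<Longrightarrow> F f = to_antidual G0 (\<Gamma>1 f)"
    and f: "f \<in> Domain (adjoint_op A)"
  shows "F f = \<Gamma>1_ext f"
proof (rule forall_in_closure_of_eq[OF _ _ F \<Gamma>1_ext_continuous(2)])
  show "f \<in> norm_topology (Domain (adjoint_op A)) (graph_norm (adjoint_op A)) closure_of Domain T"
    using Domain_dense_if_graph_dense[OF Astar_linear T_sub] T_closure f by blast
  show "Hausdorff_space (norm_topology (antidual_space G0 N) (dual_norm G0 N))"
    unfolding norm_topology_def
    by (rule Metric_space.Hausdorff_space_mtopology[OF Metric_space_norm_dist[OF norm_on_antidual[OF N_norm]]])
  show "F g = \<Gamma>1_ext g" if "g \<in> Domain T" for g using that eq \<Gamma>1_ext_eq_\<Gamma>1 by simp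
qed

section \<open>Surjectivity and the spectral parameter\<close>

text \<open>
  As \<open>B \<subseteq> A\<^sup>*\<close>, taking adjoints gives \<open>A \<subseteq> A\<^sup>*\<^sup>* \<subseteq> B\<^sup>* = B\<close>. Applied to the restrictions of \<open>T\<close> to
  \<open>ker \<Gamma>0\<close> and \<open>ker \<Gamma>1\<close>, this shows that both boundary maps vanish on \<open>dom A\<close>.
\<close>

lemma A_subset_self_adjoint:
  assumes "B \<subseteq> T" "self_adjoint B"
  shows "A \<subseteq> B"
proof (rule subrelI)
  fix v v' assume v: "(v, v') \<in> A"
  have "cinner u' v = cinner u v'" if "(u, u') \<in> B" for u u'
  proof -
    have "(u, u') \<in> adjoint_op A" using that assms(1) T_sub by blast
    then have "cinner v' u = cinner v u'" using v by (auto simp: adjoint_op_def)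
    then show ?thesis by (metis cinner_commute)
  qed
  then have "(v, v') \<in> adjoint_op B" by (auto simp: adjoint_op_def)
  then show "(v, v') \<in> B" using assms(2) by (simp add: self_adjoint_def)
qed

lemma A_ker_\<Gamma>:
  assumes "(v, v') \<in> A"
  shows "(v, v') \<in> A1" "\<Gamma>0 v = 0"
proof -
  show "(v, v') \<in> A1"
    using A_subset_self_adjoint[OF _ A1_sa] assms by (auto simp: A1_def op_restrict_def)
  show "\<Gamma>0 v = 0"
    using A_subset_self_adjoint[OF _ A0_sa] assms by (auto simp: op_restrict_def ker_on_def)
qed

lemma \<Gamma>0_resolvent_linear:
  assumes w: "w \<in> resolvent_set A1"
  shows "clinear_on UNIV (\<lambda>h. \<Gamma>0 (resolvent A1 w h))"
    and "(\<lambda>h. \<Gamma>0 (resolvent A1 w h)) ` UNIV \<subseteq> G0"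
proof -
  note graph = resolvent_graph[OF A1_linear w]
  have T: "(resolvent A1 w h, h + w *\<^sub>C resolvent A1 w h) \<in> T" for h using graph[of h] by (simp add: in_A1)
  show "clinear_on UNIV (\<lambda>h. \<Gamma>0 (resolvent A1 w h))"
    using clinear_resolvent[OF A1_linear w] \<Gamma>0_add[OF T T] \<Gamma>0_scaleC[OF T]
    by (simp add: clinear_on_def)
  show "(\<lambda>h. \<Gamma>0 (resolvent A1 w h)) ` UNIV \<subseteq> G0"
    using \<Gamma>0_in_G0[OF graph] by blast
qed

text \<open>
  Pulled back to the Hilbert space along \<open>\<Gamma>0 (A1 - w)\<inverse>\<close>, the functional \<open>\<phi>\<close> is represented by some
  \<open>k\<close>. This \<open>k\<close> is orthogonal to the range of \<open>A - w\<close>, where \<open>\<Gamma>0 (A1 - w)\<inverse>\<close> vanishes, so that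
  \<open>- k \<in> ker (A\<^sup>* - cnj w)\<close>; and for \<open>f\<close> in that kernel, \<open>\<Gamma>1_ext f (\<Gamma>0 u) = - (f, (A1 - w) u)\<close>.
\<close>

theorem \<Gamma>1_ext_surjective:
  assumes w: "w \<in> resolvent_set A1"
    and cont: "continuous_map euclidean (norm_topology G0 N) (\<lambda>h. \<Gamma>0 (resolvent A1 w h))"
    and \<phi>: "\<phi> \<in> antidual_space G0 N"
  shows "\<phi> \<in> \<Gamma>1_ext ` Domain (adjoint_op A)"
proof -
  let ?P = "\<lambda>h. \<Gamma>0 (resolvent A1 w h)"
  note P = \<Gamma>0_resolvent_linear[OF w]
  have P_G0: "?P h \<in> G0" for h using P(2) by blast
  have anti: "antilinear_on G0 \<phi>" and off: "\<And>x. x \<notin> G0 \<Longrightarrow> \<phi> x = 0"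
    using \<phi> by (auto simp: antidual_space_def)
  obtain K where K: "K \<ge> 0" "\<And>h. N (?P h) \<le> K * norm h"
    using continuous_iff_bounded[OF norm_on_UNIV N_norm clinear_on_imp_rlinear_on[OF P(1)] P(2)] cont
    by (auto simp: norm_topology_UNIV)
  obtain C where C: "C \<ge> 0" "\<forall>x\<in>G0. cmod (\<phi> x) \<le> C * N x" using antidual_bounded[OF N_norm \<phi>] by blast
  have "cmod (cnj (\<phi> (?P h))) \<le> C * K * norm h" for h
  proof -
    have "cmod (\<phi> (?P h)) \<le> C * N (?P h)" using C(2) P_G0 by blast
    also have "\<dots> \<le> C * (K * norm h)" by (intro mult_left_mono K(2) C(1))
    finally show ?thesis by (simp add: mult.assoc)
  qed
  moreover have "clinear_on UNIV (\<lambda>h. cnj (\<phi> (?P h)))"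
    using anti P(1) P_G0 by (simp add: clinear_on_def antilinear_on_def scaleC_complex_def)
  ultimately obtain k where k: "\<And>h. cnj (\<phi> (?P h)) = cinner h k"
    using Riesz_representation[of "\<lambda>h. cnj (\<phi> (?P h))" "C * K"] by blast
  have rep: "\<phi> (\<Gamma>0 u) = cinner k (u' - w *\<^sub>C u)" if "(u, u') \<in> A1" for u u'
    using k[of "u' - w *\<^sub>C u"] cinner_commute[of k] resolvent_eq[OF A1_linear w that]
    by (metis complex_cnj_cnj)
  have mk: "(- k, cnj w *\<^sub>C (- k)) \<in> adjoint_op A"
  proof -
    have "cinner v' (- k) = cinner v (cnj w *\<^sub>C (- k))" if v: "(v, v') \<in> A" for v v'
    proof -
      have "\<phi> 0 = 0" using antilinear_on_imp_rlinear_on[OF anti] G0_subspace by (rule rlinear_on_0)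
      then have "cinner (v' - w *\<^sub>C v) k = 0"
        using rep[OF A_ker_\<Gamma>(1)[OF v]] A_ker_\<Gamma>(2)[OF v] cinner_commute[of "v' - w *\<^sub>C v" k] by simp
      then show ?thesis
        by (simp add: cinner.diff_left cinner_scaleC_left cinner_scaleC_right cinner.minus_right)
    qed
    then show ?thesis by (auto simp: adjoint_op_def)
  qed
  have "\<Gamma>1_ext (- k) = \<phi>"
  proof (rule ext)
    fix x
    show "\<Gamma>1_ext (- k) x = \<phi> x"
    proof (cases "x \<in> G0")
      case True
      then obtain u u' where u: "(u, u') \<in> A1" "x = \<Gamma>0 u" by (rule G0_cases)
      then show ?thesis
        using \<Gamma>1_ext_\<Gamma>0[OF mk u(1)] rep[OF u(1)]
        by (simp add: cinner.diff_right cinner_scaleC_left cinner_scaleC_right cinner.minus_left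
            cinner.minus_right)
    qed (simp add: \<Gamma>1_ext_off off)
  qed
  then show ?thesis using mk by blast
qed

text \<open>
  The resolvent identity writes \<open>(A1 - w')\<inverse>\<close> as \<open>(A1 - w)\<inverse>\<close> after a continuous map of the
  Hilbert space to itself.
\<close>

lemma \<Gamma>0_resolvent_continuous:
  assumes w: "w \<in> resolvent_set A1" and w': "w' \<in> resolvent_set A1"
    and cont: "continuous_map euclidean (norm_topology G0 N) (\<lambda>h. \<Gamma>0 (resolvent A1 w h))"
  shows "continuous_map euclidean (norm_topology G0 N) (\<lambda>h. \<Gamma>0 (resolvent A1 w' h))"
proof -
  have res: "continuous_on UNIV (resolvent A1 w')" using w' by (simp add: resolvent_set_def)
  have "bounded_linear (\<lambda>x. (w' - w) *\<^sub>C x :: 'h)"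
    by (rule bounded_linear_intro[where K = "cmod (w' - w)"])
      (simp_all add: scaleC_add_right scaleR_scaleC scaleC_scaleC norm_scaleC mult.commute)
  then have "continuous_on UNIV (\<lambda>h. h + (w' - w) *\<^sub>C resolvent A1 w' h)"
    by (intro continuous_on_add continuous_on_id bounded_linear.continuous_on[OF _ res])
  then have "continuous_map euclidean euclidean (\<lambda>h. h + (w' - w) *\<^sub>C resolvent A1 w' h)" by simp
  from continuous_map_compose[OF this cont] show ?thesis
    by (simp add: o_def resolvent_identity[OF A1_linear w w', symmetric])
qed

end

theorem corollary2p11:
  fixes A T A1 :: "('h::chilbert_space) operator"
    and \<Gamma>0 \<Gamma>1 :: "'h \<Rightarrow> 'g::chilbert_space"
    and G0 :: "'g set"
    and N :: "'g \<Rightarrow> real"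
  assumes "separable_space (euclidean :: 'h topology)"
    and "linear_operator A" "closed A" "densely_defined A" "symmetric_operator A"
    and "quasi_boundary_triple A T \<Gamma>0 \<Gamma>1"
    and "A1 = op_restrict T (ker_on (Domain T) \<Gamma>1)"
    and "self_adjoint A1"
    and "G0 = \<Gamma>0 ` ker_on (Domain T) \<Gamma>1"
    and "closure G0 = UNIV"
    and "banach_on G0 N" "reflexive_on G0 N"
    and "continuous_map (norm_topology G0 N) euclidean (\<lambda>x. x)"
    and "\<exists>z\<in>resolvent_set A1.
           continuous_map euclidean (norm_topology G0 N) (\<lambda>h. \<Gamma>0 (resolvent A1 (cnj z) h))"
  shows "(\<forall>z\<in>resolvent_set A1.
            continuous_map euclidean (norm_topology G0 N) (\<lambda>h. \<Gamma>0 (resolvent A1 (cnj z) h))) \<and>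
         (let D = Domain (adjoint_op A);
              continuous_extension =
                (\<lambda>F. continuous_map (norm_topology D (graph_norm (adjoint_op A)))
                       (norm_topology (antidual_space G0 N) (dual_norm G0 N)) F \<and>
                     (\<forall>f\<in>Domain T. F f = to_antidual G0 (\<Gamma>1 f)))
          in \<exists>F. continuous_extension F \<and> clinear_on D F \<and> F ` D = antidual_space G0 N \<and>
                 (\<forall>F'. continuous_extension F' \<longrightarrow> (\<forall>f\<in>D. F' f = F f)))"
proof -
  interpret boundary_setting A T A1 \<Gamma>0 \<Gamma>1 G0 N
    by (rule boundary_setting.intro[OF assms(4,6,7,8,9,11,13)])
  obtain z where z: "z \<in> resolvent_set A1"
    and cont: "continuous_map euclidean (norm_topology G0 N) (\<lambda>h. \<Gamma>0 (resolvent A1 (cnj z) h))"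
    using assms(14) by blast
  note w = resolvent_set_cnj[OF A1_sa z]
  have all: "continuous_map euclidean (norm_topology G0 N) (\<lambda>h. \<Gamma>0 (resolvent A1 (cnj z') h))"
    if "z' \<in> resolvent_set A1" for z'
    by (rule \<Gamma>0_resolvent_continuous[OF w resolvent_set_cnj[OF A1_sa that] cont])
  have onto: "\<Gamma>1_ext ` Domain (adjoint_op A) = antidual_space G0 N"
    by (intro equalityI subsetI \<Gamma>1_ext_surjective[OF w cont])
      (erule subsetD[OF \<Gamma>1_ext_continuous(1)])
  have unique: "F f = \<Gamma>1_ext f"
    if "continuous_map (norm_topology (Domain (adjoint_op A)) (graph_norm (adjoint_op A)))
          (norm_topology (antidual_space G0 N) (dual_norm G0 N)) F \<and>
        (\<forall>f\<in>Domain T. F f = to_antidual G0 (\<Gamma>1 f))" "f \<in> Domain (adjoint_op A)" for F f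
    by (rule continuous_extension_unique[OF conjunct1[OF that(1)] bspec[OF conjunct2[OF that(1)]] that(2)])
  show ?thesis
    unfolding Let_def
    by (intro conjI exI[of _ \<Gamma>1_ext] ballI allI impI all onto unique
        \<Gamma>1_ext_continuous(2) \<Gamma>1_ext_linear \<Gamma>1_ext_eq_\<Gamma>1) blast+
qed

end
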